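(* Let $\alpha$ be a measurable function on $(0,1]$ with values in $(0,\infty)$ and with $\inf_{\varepsilon\le t\le 1}\alpha(t)>0$ for each $\varepsilon\in(0,1]$. Suppose $1<p\le\infty$. If $$\lim_{t\to0}t^{\alpha(t)}=0,$$ then $R^{\alpha(\cdot)}$ is a compact operator in $L_p[0,1]$. Conversely, if $$\liminf_{t\to0}t^{\alpha(t)}>0,$$ then $R^{\alpha(\cdot)}$ is non-compact (as an operator in $L_p[0,1]$).
   Context: For a measurable, almost everywhere positive function $\alpha$ on $[0,1]$, the Riemann--Liouville operator of variable order is $$(R^{\alpha(\cdot)}f)(t):=\frac{1}{\Gamma(\alpha(t))}\int_0^t (t-s)^{\alpha(t)-1}f(s)\,ds,\qquad t\in[0,1],$$ for $f\in L_1[0,1]$ (the integral exists for almost every $t$). For $1<p\le\infty$ it is a bounded operator from $L_p[0,1]$ to $L_p[0,1]$; "operator in $L_p[0,1]$" means operator from $L_p[0,1]$ to $L_p[0,1]$. *)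

theory Defs
  imports "HOL-Analysis.Analysis" "HOL-Probability.Essential_Supremum"
begin

abbreviation unit_meas :: "real measure" where
  "unit_meas \<equiv> lebesgue_on {0..1}"

text \<open>Real-valued functions representing the elements of \<open>L\<^sub>p[0,1]\<close> and their norm; the exponent
  \<open>p\<close> is an extended nonnegative real, \<open>p = \<infinity>\<close> giving the essential supremum norm.\<close>

definition Lp_functions :: "ennreal \<Rightarrow> (real \<Rightarrow> real) set" where
  "Lp_functions p = {f \<in> borel_measurable unit_meas.
     if p = \<infinity> then esssup unit_meas (\<lambda>t. ennreal \<bar>f t\<bar>) < \<infinity>
     else integrable unit_meas (\<lambda>t. \<bar>f t\<bar> powr enn2real p)}"

definition Lp_norm :: "ennreal \<Rightarrow> (real \<Rightarrow> real) \<Rightarrow> real" where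
  "Lp_norm p f =
     (if p = \<infinity> then enn2real (esssup unit_meas (\<lambda>t. ennreal \<bar>f t\<bar>))
      else (LINT t|unit_meas. \<bar>f t\<bar> powr enn2real p) powr (1 / enn2real p))"

definition AE_rel :: "ennreal \<Rightarrow> ((real \<Rightarrow> real) \<times> (real \<Rightarrow> real)) set" where
  "AE_rel p = {(f, g). f \<in> Lp_functions p \<and> g \<in> Lp_functions p \<and> (AE t in unit_meas. f t = g t)}"

definition Lp_space :: "ennreal \<Rightarrow> (real \<Rightarrow> real) set set" where
  "Lp_space p = Lp_functions p // AE_rel p"

definition Lp_class :: "ennreal \<Rightarrow> (real \<Rightarrow> real) \<Rightarrow> (real \<Rightarrow> real) set" where
  "Lp_class p f = AE_rel p `` {f}"

definition Lp_dist :: "ennreal \<Rightarrow> (real \<Rightarrow> real) set \<Rightarrow> (real \<Rightarrow> real) set \<Rightarrow> real" where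
  "Lp_dist p X Y = Lp_norm p (\<lambda>t. (SOME f. f \<in> X) t - (SOME g. g \<in> Y) t)"

text \<open>The Minkowski inequality and the metric axioms for the equivalence classes, which justify
  the topology used below.\<close>

lemma powr_convex_nonneg:
  assumes "(q::real) \<ge> 1" "x \<ge> 0" "y \<ge> 0" "0 < u" "0 < v" "u + v = 1"
  shows "(u * x + v * y) powr q \<le> u * x powr q + v * y powr q"
proof -
  have le: "w powr q \<le> w" if "0 < w" "w \<le> 1" for w :: real
    using powr_mono'[of 1 q w] that assms(1) by simp
  consider "x = 0" | "y = 0" | "x > 0" "y > 0" using assms by linarith
  then show ?thesis
  proof cases
    case 1
    then show ?thesis using le[of v] assms by (auto simp: powr_mult intro!: mult_right_mono)
  next
    case 2
    then show ?thesis using le[of u] assms by (auto simp: powr_mult intro!: mult_right_mono)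
  next
    case 3
    have u: "u = 1 - v" using assms by simp
    show ?thesis
      using convex_onD[OF powr_convex[OF assms(1)], of v x y] assms 3
      by (simp add: u)
  qed
qed

lemma enn2real_ge_1:
  assumes "1 < p" "p \<noteq> \<infinity>"
  shows "1 \<le> enn2real p"
  using assms by (cases p) (auto simp: ennreal_1[symmetric] ennreal_less_iff simp del: ennreal_1)

lemma Lp_norm_nonneg: "0 \<le> Lp_norm p f"
  by (simp add: Lp_norm_def)

lemma Lp_norm_eq_0_iff:
  assumes "1 < p" "f \<in> Lp_functions p"
  shows "Lp_norm p f = 0 \<longleftrightarrow> (AE t in unit_meas. f t = 0)"
proof (cases "p = \<infinity>")
  case True
  have m: "(\<lambda>t. ennreal \<bar>f t\<bar>) \<in> borel_measurable unit_meas"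
    using assms by (auto simp: Lp_functions_def)
  have "Lp_norm p f = 0 \<longleftrightarrow> esssup unit_meas (\<lambda>t. ennreal \<bar>f t\<bar>) = 0"
    using assms True by (auto simp: Lp_norm_def Lp_functions_def enn2real_eq_0_iff)
  also have "\<dots> \<longleftrightarrow> (AE t in unit_meas. f t = 0)"
    using esssup_AE[of "\<lambda>t. ennreal \<bar>f t\<bar>" unit_meas]
      esssup_I[OF m, of 0] by (auto simp: ennreal_eq_0_iff)
  finally show ?thesis .
next
  case False
  then have "integrable unit_meas (\<lambda>t. \<bar>f t\<bar> powr enn2real p)"
    using assms by (auto simp: Lp_functions_def)
  from integral_nonneg_eq_0_iff_AE[OF this] enn2real_ge_1[OF assms(1) False] show ?thesis
    by (auto simp: Lp_norm_def False powr_eq_0_iff)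
qed

lemma Lp_add:
  assumes p: "1 < p" and f: "f \<in> Lp_functions p" and g: "g \<in> Lp_functions p"
  shows "(\<lambda>t. f t + g t) \<in> Lp_functions p"
    and "Lp_norm p (\<lambda>t. f t + g t) \<le> Lp_norm p f + Lp_norm p g"
proof -
  have m [measurable]: "f \<in> borel_measurable unit_meas" "g \<in> borel_measurable unit_meas"
    using f g by (auto simp: Lp_functions_def)
  have "(\<lambda>t. f t + g t) \<in> Lp_functions p \<and> Lp_norm p (\<lambda>t. f t + g t) \<le> Lp_norm p f + Lp_norm p g"
  proof (cases "p = \<infinity>")
    case True
    define E where "E h = esssup unit_meas (\<lambda>t. ennreal \<bar>h t\<bar>)" for h :: "real \<Rightarrow> real"
    have fin: "E f < \<infinity>" "E g < \<infinity>" using f g True by (auto simp: Lp_functions_def E_def)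
    have "E (\<lambda>t. f t + g t) \<le> E f + E g"
      unfolding E_def
    proof (rule esssup_I)
      show "AE t in unit_meas. ennreal \<bar>f t + g t\<bar>
        \<le> esssup unit_meas (\<lambda>t. ennreal \<bar>f t\<bar>) + esssup unit_meas (\<lambda>t. ennreal \<bar>g t\<bar>)"
        using esssup_AE[of "\<lambda>t. ennreal \<bar>f t\<bar>" unit_meas] esssup_AE[of "\<lambda>t. ennreal \<bar>g t\<bar>" unit_meas]
      proof eventually_elim
        case (elim t)
        have "ennreal \<bar>f t + g t\<bar> \<le> ennreal \<bar>f t\<bar> + ennreal \<bar>g t\<bar>"
          by (simp add: ennreal_plus[symmetric] del: ennreal_plus) 
        with elim show ?case by (meson add_mono order_trans)
      qed
    qed measurable
    moreover have sum: "E f + E g < \<infinity>" using fin by (simp add: ennreal_add_less_top)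
    ultimately have "E (\<lambda>t. f t + g t) < \<infinity>"
      and "enn2real (E (\<lambda>t. f t + g t)) \<le> enn2real (E f) + enn2real (E g)"
      using fin by (auto simp: enn2real_plus[symmetric] intro: enn2real_mono le_less_trans)
    then show ?thesis using True
      by (auto simp: Lp_functions_def Lp_norm_def E_def[symmetric])
  next
    case False
    define q where "q = enn2real p"
    have q: "1 \<le> q" using enn2real_ge_1[OF p False] by (simp add: q_def)
    define I where "I h = (LINT t|unit_meas. \<bar>h t\<bar> powr q)" for h :: "real \<Rightarrow> real"
    have N: "Lp_norm p h = I h powr (1 / q)" for h unfolding Lp_norm_def I_def q_def using False by simp
    have I0: "0 \<le> I h" for h by (simp add: I_def)
    have NI: "Lp_norm p h powr q = I h" for h using q I0[of h] by (simp add: N powr_powr)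
    have int: "integrable unit_meas (\<lambda>t. \<bar>f t\<bar> powr q)" "integrable unit_meas (\<lambda>t. \<bar>g t\<bar> powr q)"
      using f g False by (auto simp: Lp_functions_def q_def)
    have main: "integrable unit_meas (\<lambda>t. \<bar>f t + g t\<bar> powr q) \<and> Lp_norm p (\<lambda>t. f t + g t) \<le> A + B"
      if A: "A > 0" "Lp_norm p f \<le> A" and B: "B > 0" "Lp_norm p g \<le> B" for A B
    proof -
      let ?S = "A + B"
      have pw: "\<bar>f t + g t\<bar> powr q \<le> ?S powr q * (A/?S * (\<bar>f t\<bar> powr q / A powr q) + B/?S * (\<bar>g t\<bar> powr q / B powr q))" for t
      proof -
        have "\<bar>f t + g t\<bar> powr q \<le> (\<bar>f t\<bar> + \<bar>g t\<bar>) powr q"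
          using q by (intro powr_mono2) auto
        also have "\<bar>f t\<bar> + \<bar>g t\<bar> = ?S * (A/?S * (\<bar>f t\<bar>/A) + B/?S * (\<bar>g t\<bar>/B))"
          using A B by (simp add: distrib_left)
        also have "\<dots> powr q = ?S powr q * (A/?S * (\<bar>f t\<bar>/A) + B/?S * (\<bar>g t\<bar>/B)) powr q"
          by (rule powr_mult)
        also have "\<dots> \<le> ?S powr q * (A/?S * (\<bar>f t\<bar>/A) powr q + B/?S * (\<bar>g t\<bar>/B) powr q)"
          using A B q by (intro mult_left_mono powr_convex_nonneg) (auto simp: add_divide_distrib[symmetric])
        finally show ?thesis using A B by (simp add: powr_divide)
      qed
      have i: "integrable unit_meas (\<lambda>t. \<bar>f t + g t\<bar> powr q)"
      proof (rule Bochner_Integration.integrable_bound)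
        show "integrable unit_meas (\<lambda>t. ?S powr q * (A/?S * (\<bar>f t\<bar> powr q / A powr q) + B/?S * (\<bar>g t\<bar> powr q / B powr q)))"
          using int by simp
        show "AE t in unit_meas. norm (\<bar>f t + g t\<bar> powr q)
          \<le> norm (?S powr q * (A/?S * (\<bar>f t\<bar> powr q / A powr q) + B/?S * (\<bar>g t\<bar> powr q / B powr q)))"
        proof (rule AE_I2)
          fix t
          show "norm (\<bar>f t + g t\<bar> powr q)
            \<le> norm (?S powr q * (A/?S * (\<bar>f t\<bar> powr q / A powr q) + B/?S * (\<bar>g t\<bar> powr q / B powr q)))"
            using order_trans[OF pw[of t] abs_ge_self] by (simp only: real_norm_def abs_of_nonneg[OF powr_ge_zero])
        qed
      qed measurable
      have "I (\<lambda>t. f t + g t) \<le> ?S powr q * (A/?S * (I f / A powr q) + B/?S * (I g / B powr q))"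
        unfolding I_def using integral_mono[OF i _ pw] int by simp
      also have "\<dots> \<le> ?S powr q * (A/?S * 1 + B/?S * 1)"
        using A B q Lp_norm_nonneg powr_mono2[of q "Lp_norm p f" A] powr_mono2[of q "Lp_norm p g" B]
        by (intro mult_left_mono add_mono) (auto simp: NI)
      also have "\<dots> = ?S powr q" using A B by (simp add: add_divide_distrib[symmetric])
      finally have "I (\<lambda>t. f t + g t) powr (1/q) \<le> (?S powr q) powr (1/q)"
        using q I0 by (intro powr_mono2) auto
      also have "\<dots> = ?S" using A B q by (simp add: powr_powr)
      finally show ?thesis using i by (simp add: N)
    qed
    have "Lp_norm p (\<lambda>t. f t + g t) \<le> Lp_norm p f + Lp_norm p g"
    proof (rule field_le_epsilon)
      fix e :: real assume "e > 0"
      then show "Lp_norm p (\<lambda>t. f t + g t) \<le> Lp_norm p f + Lp_norm p g + e"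
        using main[of "Lp_norm p f + e/2" "Lp_norm p g + e/2"] Lp_norm_nonneg[of p f] Lp_norm_nonneg[of p g]
        by (simp add: algebra_simps)
    qed
    moreover have "integrable unit_meas (\<lambda>t. \<bar>f t + g t\<bar> powr q)"
      using main[of "Lp_norm p f + 1" "Lp_norm p g + 1"] Lp_norm_nonneg[of p f] Lp_norm_nonneg[of p g] by simp
    ultimately show ?thesis using False by (simp add: Lp_functions_def q_def)
  qed
  then show "(\<lambda>t. f t + g t) \<in> Lp_functions p"
    and "Lp_norm p (\<lambda>t. f t + g t) \<le> Lp_norm p f + Lp_norm p g" by auto
qed

lemma Lp_minus: "f \<in> Lp_functions p \<Longrightarrow> (\<lambda>t. - f t) \<in> Lp_functions p"
  by (auto simp: Lp_functions_def)

lemma Lp_diff: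
  assumes "1 < p" "f \<in> Lp_functions p" "g \<in> Lp_functions p"
  shows "(\<lambda>t. f t - g t) \<in> Lp_functions p"
  using Lp_add(1)[OF assms(1,2) Lp_minus[OF assms(3)]] by simp

lemma equiv_AE_rel: "equiv (Lp_functions p) (AE_rel p)"
proof (rule equivI)
  show "trans (AE_rel p)"
    unfolding trans_def AE_rel_def by (auto elim: eventually_elim2)
qed (auto simp: AE_rel_def refl_on_def sym_def elim: eventually_mono)

lemma Lp_rep:
  assumes "X \<in> Lp_space p"
  shows "(SOME f. f \<in> X) \<in> X" "(SOME f. f \<in> X) \<in> Lp_functions p"
proof -
  have "X \<noteq> {}" "X \<subseteq> Lp_functions p"
    using assms equiv_AE_rel[of p] unfolding Lp_space_def
    by (auto simp: in_quotient_imp_non_empty dest: in_quotient_imp_subset)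
  then show "(SOME f. f \<in> X) \<in> X" "(SOME f. f \<in> X) \<in> Lp_functions p"
    using some_in_eq by blast+
qed

lemma Metric_space_Lp:
  assumes p: "1 < p"
  shows "Metric_space (Lp_space p) (Lp_dist p)"
proof
  fix X Y assume XY: "X \<in> Lp_space p" "Y \<in> Lp_space p"
  let ?x = "SOME f. f \<in> X" and ?y = "SOME f. f \<in> Y"
  have "Lp_dist p X Y = 0 \<longleftrightarrow> (?x, ?y) \<in> AE_rel p"
    using Lp_rep[OF XY(1)] Lp_rep[OF XY(2)] Lp_norm_eq_0_iff[OF p Lp_diff[OF p]]
    by (simp add: Lp_dist_def AE_rel_def)
  also have "\<dots> \<longleftrightarrow> X = Y"
    using Lp_rep[OF XY(1)] Lp_rep[OF XY(2)] XY equiv_AE_rel[of p] unfolding Lp_space_def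
    by (meson quotient_eqI quotient_eq_iff)
  finally show "Lp_dist p X Y = 0 \<longleftrightarrow> X = Y" .
next
  fix X Y Z assume XYZ: "X \<in> Lp_space p" "Y \<in> Lp_space p" "Z \<in> Lp_space p"
  then show "Lp_dist p X Z \<le> Lp_dist p X Y + Lp_dist p Y Z"
    using Lp_add(2)[OF p Lp_diff[OF p Lp_rep(2) Lp_rep(2)] Lp_diff[OF p Lp_rep(2) Lp_rep(2)], of X Y Y Z]
    by (simp add: Lp_dist_def)
qed (auto simp: Lp_dist_def Lp_norm_nonneg Lp_norm_def abs_minus_commute)

definition Lp_topology :: "ennreal \<Rightarrow> (real \<Rightarrow> real) set topology" where
  "Lp_topology p = Metric_space.mtopology (Lp_space p) (Lp_dist p)"

text \<open>Operators are given on representatives.  Linearity (up to null sets) and boundedness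
  together imply that \<open>T\<close> respects almost everywhere equality, so that it induces an
  operator on the equivalence classes.\<close>

definition bounded_operator_in_Lp :: "ennreal \<Rightarrow> ((real \<Rightarrow> real) \<Rightarrow> real \<Rightarrow> real) \<Rightarrow> bool" where
  "bounded_operator_in_Lp p T \<longleftrightarrow>
     (\<forall>f \<in> Lp_functions p. T f \<in> Lp_functions p) \<and>
     (\<forall>f \<in> Lp_functions p. \<forall>g \<in> Lp_functions p. \<forall>a b.
        AE t in unit_meas. T (\<lambda>s. a * f s + b * g s) t = a * T f t + b * T g t) \<and>
     (\<exists>C. \<forall>f \<in> Lp_functions p. Lp_norm p (T f) \<le> C * Lp_norm p f)"

definition compact_operator_in_Lp :: "ennreal \<Rightarrow> ((real \<Rightarrow> real) \<Rightarrow> real \<Rightarrow> real) \<Rightarrow> bool" where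
  "compact_operator_in_Lp p T \<longleftrightarrow>
     bounded_operator_in_Lp p T \<and>
     compactin (Lp_topology p)
       (Lp_topology p closure_of
          ((\<lambda>f. Lp_class p (T f)) ` {f \<in> Lp_functions p. Lp_norm p f \<le> 1}))"

text \<open>The value at \<open>t\<close> is meaningful where the integral exists, which is the case for almost every
  \<open>t\<close>; elsewhere the library's convention assigns the integral the value \<open>0\<close>.\<close>

definition riemann_liouville :: "(real \<Rightarrow> real) \<Rightarrow> (real \<Rightarrow> real) \<Rightarrow> real \<Rightarrow> real" where
  "riemann_liouville \<alpha> f t =
     1 / Gamma (\<alpha> t) * (LINT s:{0..t}|lebesgue. (t - s) powr (\<alpha> t - 1) * f s)"

end

theory Submission
  imports Defs
begin

text \<open>
  Let \<open>R\<close> be the Riemann--Liouville operator of variable order.  The key fact is a bound of \<open>R\<close> by a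
  maximal function: cutting the kernel \<open>(t - s) powr (a - 1)\<close> dyadically at its singularity and summing
  a geometric series shows that \<open>|R f t| \<le> t powr \<alpha> t * g t\<close>, where \<open>g\<close> is a constant multiple of the
  one-sided Hardy--Littlewood maximal function of \<open>f\<close> and the constant does not depend on the order
  (\<open>riemann_liouville_majorant\<close>).  The maximal theorem, obtained from Vitali's covering lemma and the
  layer-cake formula (\<open>left_maximal_strong_type\<close>), bounds \<open>g\<close> in \<open>L\<^sub>p\<close> for \<open>1 < p \<le> \<infinity>\<close>.  Since
  \<open>t powr \<alpha> t \<le> 1\<close>, the operator is bounded (\<open>riemann_liouville_bounded\<close>).

  Suppose that \<open>t powr \<alpha> t\<close> tends to 0.  The same estimate shows that \<open>R\<close> is small in norm near \<open>t = 0\<close>.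
  Away from 0 the order is bounded below by some \<open>c > 0\<close>, and truncating the kernel at distance \<open>d\<close> from
  its singularity costs only \<open>d powr c * g t\<close> when \<open>d \<le> 1\<close>.  The truncated kernel depends continuously on the
  point and on the order, so the truncated integrals of the functions in the unit ball are, up to any
  prescribed error, finitely many functions of \<open>(t, \<alpha> t)\<close>; large orders do not matter, since \<open>1 / Gamma\<close>
  tends to 0.  The image of the unit ball is therefore totally bounded, and it is relatively compact because
  \<open>L\<^sub>p\<close> is complete (\<open>Lp_complete\<close>, \<open>Lp_relatively_compactI\<close>).

  If instead \<open>t powr \<alpha> t \<ge> c > 0\<close> near 0, then \<open>R\<close> acts on normalised indicators of the intervals
  \<open>[x/2, x]\<close>, \<open>x = 2 ^ (-n)\<close>, without loss of norm up to a constant factor, and their images are uniformly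
  separated (\<open>riemann_liouville_not_compact\<close>).
\<close>

section \<open>The reciprocal Gamma function on the half-line\<close>

lemma rGamma_real_nonneg: "0 \<le> rGamma x" if "0 \<le> x" for x :: real
  using that Gamma_real_nonneg[of x] by (cases "x = 0") (auto simp: rGamma_inverse_Gamma)

lemma rGamma_real_bounded:
  obtains B :: real where "0 < B" "\<And>x. 0 \<le> x \<Longrightarrow> rGamma x \<le> B"
proof -
  have "compact (rGamma ` {0..2::real})"
    by (intro compact_continuous_image continuous_on_rGamma) auto
  then obtain B where B: "\<And>x. x \<in> {0..2::real} \<Longrightarrow> norm (rGamma x) \<le> B"
    unfolding bounded_iff by (meson bounded_iff compact_imp_bounded imageI)
  define B' where "B' = max B 1"
  have *: "rGamma x \<le> B'" if "0 \<le> x" "x \<le> 2 + real n" for x n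
    using that
  proof (induction n arbitrary: x)
    case 0
    then show ?case using B[of x] by (auto simp: B'_def)
  next
    case (Suc n)
    show ?case
    proof (cases "x \<le> 2")
      case True
      then show ?thesis using B[of x] Suc.prems by (auto simp: B'_def)
    next
      case False
      have "rGamma x \<le> (x - 1) * rGamma x"
        using False rGamma_real_nonneg[of x] mult_right_mono[of 1 "x - 1" "rGamma x"] by auto
      also have "\<dots> = rGamma (x - 1)" using rGamma_plus1[of "x - 1"] by simp
      also have "\<dots> \<le> B'" using Suc.IH[of "x - 1"] Suc.prems False by auto
      finally show ?thesis .
    qed
  qed
  show ?thesis
  proof
    show "0 < B'" by (simp add: B'_def)
    show "rGamma x \<le> B'" if "0 \<le> x" for x
      using *[of x "nat \<lceil>x\<rceil>"] that by linarith
  qed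
qed

lemma rGamma_real_tendsto_0: "((rGamma :: real \<Rightarrow> real) \<longlongrightarrow> 0) at_top"
proof -
  obtain B :: real where B: "0 < B" "\<And>x. 0 \<le> x \<Longrightarrow> rGamma x \<le> B" by (rule rGamma_real_bounded) blast
  have le: "rGamma x \<le> B / (x - 1)" if "x > 1" for x
    using rGamma_plus1[of "x - 1"] B(2)[of "x - 1"] that by (simp add: pos_le_divide_eq mult.commute)
  show ?thesis
  proof (rule tendsto_sandwich)
    show "\<forall>\<^sub>F x in at_top. 0 \<le> (rGamma x :: real)"
      using eventually_ge_at_top[of 0] by eventually_elim (rule rGamma_real_nonneg)
    show "\<forall>\<^sub>F x in at_top. (rGamma x :: real) \<le> B / (x - 1)"
      using eventually_gt_at_top[of 1] by eventually_elim (rule le)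
    show "((\<lambda>x. B / (x - 1)) \<longlongrightarrow> 0) at_top" by (intro tendsto_divide_0[OF tendsto_const] filterlim_at_top_imp_at_infinity) (simp add: filterlim_at_top_add_at_top filterlim_tendsto_add_at_top[OF tendsto_const[of "-1"] filterlim_ident, simplified])
  qed auto
qed

text \<open>The factor \<open>1 / (1 - 2 powr (-a))\<close> comes from summing a geometric series over dyadic pieces of the
  singular kernel.  It blows up like \<open>1 / a\<close> at \<open>a = 0\<close>, where \<open>rGamma a\<close> vanishes to first order,
  so the product is bounded uniformly in the order \<open>a\<close>.\<close>

lemma rGamma_geometric_bound:
  obtains D :: real where "0 < D" "\<And>a. 0 < a \<Longrightarrow> rGamma a / (1 - 2 powr (-a)) \<le> D"
proof -
  obtain B :: real where B: "0 < B" "\<And>x. 0 \<le> x \<Longrightarrow> rGamma x \<le> B" by (rule rGamma_real_bounded) blast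
  show ?thesis
  proof
    show "0 < B / ln 2 + B" using B by (simp add: add_pos_pos)
    fix a :: real assume a: "0 < a"
    have ln2: "ln 2 > (0::real)" by simp
    have "2 powr (-a) \<le> 1 / (1 + a * ln 2)"
    proof -
      \<comment> \<open>The inequality \<open>exp x \<ge> 1 + x\<close> at \<open>x = a * ln 2\<close>.\<close>
      have "1 + a * ln 2 \<le> 2 powr a" using exp_ge_add_one_self[of "a * ln 2"] by (simp add: powr_def)
      moreover have "0 < 1 + a * ln 2" using a ln2 by (simp add: add_pos_pos)
      ultimately show ?thesis by (simp add: powr_minus divide_inverse le_imp_inverse_le)
    qed
    moreover have pos: "0 < 1 + a * ln 2" using a ln2 by (simp add: add_pos_pos)
    ultimately have q: "a * ln 2 / (1 + a * ln 2) \<le> 1 - 2 powr (-a)"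
      by (simp add: field_simps)
    have p: "0 < a * ln 2 / (1 + a * ln 2)" using a ln2 pos by simp
    have "rGamma a / (1 - 2 powr (-a)) \<le> rGamma a / (a * ln 2 / (1 + a * ln 2))"
      using a p q rGamma_real_nonneg[of a] by (intro divide_left_mono mult_pos_pos) auto
    also have "\<dots> = rGamma (a + 1) / ln 2 + rGamma a"
      using a ln2 rGamma_plus1[of a, symmetric] by (simp add: field_simps)
    also have "\<dots> \<le> B / ln 2 + B"
      using a B(2)[of a] B(2)[of "a+1"] by (intro add_mono divide_right_mono) auto
    finally show "rGamma a / (1 - 2 powr (-a)) \<le> B / ln 2 + B" .
  qed
qed

section \<open>The one-sided maximal function\<close>

lemma emeasure_UN_le_count_space:
  assumes "countable C" and X[measurable]: "\<And>i. i \<in> C \<Longrightarrow> X i \<in> sets M"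
  shows "emeasure M (\<Union>i\<in>C. X i) \<le> (\<integral>\<^sup>+i. emeasure M (X i) \<partial>count_space C)"
proof -
  have "emeasure M (\<Union>i\<in>C. X i) = (\<integral>\<^sup>+x. indicator (\<Union>i\<in>C. X i) x \<partial>M)"
    using assms by (subst nn_integral_indicator) auto
  also have "\<dots> \<le> (\<integral>\<^sup>+x. (\<integral>\<^sup>+i. indicator (X i) x \<partial>count_space C) \<partial>M)"
  proof (rule nn_integral_mono)
    fix x
    show "indicator (\<Union>i\<in>C. X i) x \<le> (\<integral>\<^sup>+i. indicator (X i) x \<partial>count_space C)"
    proof (cases "x \<in> (\<Union>i\<in>C. X i)")
      case True
      then obtain i where i: "i \<in> C" "x \<in> X i" by auto
      show ?thesis using nn_integral_ge_point[OF i(1), of "\<lambda>i. indicator (X i) x"] i True by auto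
    qed auto
  qed
  also have "\<dots> = (\<integral>\<^sup>+i. (\<integral>\<^sup>+x. indicator (X i) x \<partial>M) \<partial>count_space C)"
    using assms by (subst nn_integral_count_space_nn_integral) auto
  also have "\<dots> = (\<integral>\<^sup>+i. emeasure M (X i) \<partial>count_space C)"
    using assms by (intro nn_integral_cong) auto
  finally show ?thesis .
qed

text \<open>The weak type \<open>(1,1)\<close> inequality.  Each point \<open>t\<close> of \<open>E\<close> is the right end of an interval on which
  the average of \<open>v\<close> exceeds \<open>l\<close>; Vitali's covering lemma extracts a disjoint countable family
  whose fivefold enlargements still cover \<open>E\<close>.\<close>

lemma left_average_weak_type:
  fixes v :: "real \<Rightarrow> ennreal" and l :: real
  assumes v[measurable]: "v \<in> borel_measurable borel"
    and fin: "(\<integral>\<^sup>+s. v s \<partial>lborel) < \<infinity>" and l: "0 < l"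
    and E[measurable]: "E \<in> sets borel"
    and avg: "\<And>t. t \<in> E \<Longrightarrow> \<exists>h>0. ennreal (l * h) < (\<integral>\<^sup>+s\<in>{t-h..t}. v s \<partial>lborel)"
  shows "ennreal l * emeasure lborel E \<le> 5 * (\<integral>\<^sup>+s. v s \<partial>lborel)"
proof -
  let ?V = "\<integral>\<^sup>+s. v s \<partial>lborel"
  obtain h where h: "\<And>t. t \<in> E \<Longrightarrow> 0 < h t"
    and hl: "\<And>t. t \<in> E \<Longrightarrow> ennreal (l * h t) < (\<integral>\<^sup>+s\<in>{t-h t..t}. v s \<partial>lborel)"
    using avg by metis
  have cb: "cball (t - h t / 2) (h t / 2) = {t - h t..t}" if "t \<in> E" for t
    using h[OF that] by (simp add: cball_eq_atLeastAtMost)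
  have hB: "h t / 2 \<le> enn2real ?V / l / 2" if "t \<in> E" for t
  proof -
    have "ennreal (l * h t) \<le> ?V"
      using hl[OF that] by (rule order_trans[OF less_imp_le]) (auto intro!: nn_integral_mono split: split_indicator)
    then have "l * h t \<le> enn2real ?V"
      using fin l h[OF that] by (metis enn2real_ennreal enn2real_mono less_eq_real_def mult_nonneg_nonneg infinity_ennreal_def)
    then show ?thesis using l by (simp add: field_simps)
  qed
  obtain C where C: "countable C" "C \<subseteq> E"
    and disj: "pairwise (\<lambda>i j. disjnt (cball (i - h i / 2) (h i / 2)) (cball (j - h j / 2) (h j / 2))) C"
    and cov: "E \<subseteq> (\<Union>i\<in>C. cball (i - h i / 2) (5 * (h i / 2)))"
  proof (rule Vitali_covering_lemma_cballs[where S = E and K = E and a = "\<lambda>t. t - h t / 2"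
        and r = "\<lambda>t. h t / 2" and B = "enn2real ?V / l / 2"])
    show "E \<subseteq> (\<Union>i\<in>E. cball (i - h i / 2) (h i / 2))" using cb h by fastforce
  qed (use h hB in auto)
  have "emeasure lborel E \<le> emeasure lborel (\<Union>i\<in>C. cball (i - h i / 2) (5 * (h i / 2)))"
    using cov C by (intro emeasure_mono) (auto intro!: sets.countable_UN')
  also have "\<dots> \<le> (\<integral>\<^sup>+i. emeasure lborel (cball (i - h i / 2) (5 * (h i / 2))) \<partial>count_space C)"
    using C by (intro emeasure_UN_le_count_space) auto
  also have "\<dots> = (\<integral>\<^sup>+i. ennreal (5 * h i) \<partial>count_space C)"
    using C h by (intro nn_integral_cong)
      (auto simp: cball_eq_atLeastAtMost emeasure_lborel_Icc_eq subset_iff dest!: less_imp_le)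
  finally have "ennreal l * emeasure lborel E \<le> ennreal l * (\<integral>\<^sup>+i. ennreal (5 * h i) \<partial>count_space C)"
    by (rule mult_left_mono) simp
  also have "\<dots> = 5 * (\<integral>\<^sup>+i. ennreal (l * h i) \<partial>count_space C)"
    using l h C by (subst (1 2) nn_integral_cmult[symmetric])
      (auto intro!: nn_integral_cong simp: ennreal_mult'' ennreal_mult' mult_ac subset_iff)
  also have "\<dots> \<le> 5 * (\<integral>\<^sup>+i. emeasure (density lborel v) {i - h i..i} \<partial>count_space C)"
    using C hl by (intro mult_left_mono nn_integral_mono) (auto simp: emeasure_density subset_iff less_imp_le)
  also have "\<dots> = 5 * emeasure (density lborel v) (\<Union>i\<in>C. {i - h i..i})"
    using C disj cb by (subst emeasure_UN_countable)
      (auto simp: disjoint_family_on_def pairwise_def disjnt_def subset_iff)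
  also have "\<dots> \<le> 5 * emeasure (density lborel v) UNIV"
    by (intro mult_left_mono emeasure_mono) auto
  also have "\<dots> = 5 * ?V" by (simp add: emeasure_density)
  finally show ?thesis .
qed

text \<open>The one-sided maximal function: the supremum of the averages of \<open>v\<close> over intervals with right end
  \<open>t\<close>.  Only rational lengths are used, so that measurability is immediate; by monotonicity of the
  integral this does not change the supremum.\<close>

definition left_maximal :: "(real \<Rightarrow> ennreal) \<Rightarrow> real \<Rightarrow> ennreal" where
  "left_maximal v t = (SUP h\<in>{h \<in> \<rat>. 0 < h}. (\<integral>\<^sup>+s\<in>{t-h..t}. v s \<partial>lborel) / ennreal h)"

lemma left_maximal_measurable [measurable]:
  assumes [measurable]: "v \<in> borel_measurable borel"
  shows "left_maximal v \<in> borel_measurable borel"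
proof -
  have "(\<lambda>t. \<integral>\<^sup>+s. v s * indicator {t-h..t} s \<partial>lborel) \<in> borel_measurable borel" for h
  proof -
    have "(\<lambda>t. \<integral>\<^sup>+s. v s * indicator {x::real\<times>real. fst x - h \<le> snd x \<and> snd x \<le> fst x} (t, s) \<partial>lborel)
       \<in> borel_measurable borel" by measurable
    then show ?thesis by (simp add: indicator_def)
  qed
  then show ?thesis unfolding left_maximal_def
    by (intro borel_measurable_SUP borel_measurable_divide_ennreal) (auto intro: countable_subset[OF _ countable_rat])
qed

lemma less_left_maximal:
  assumes "ennreal l < left_maximal v t" "0 \<le> l"
  shows "\<exists>h>0. ennreal (l * h) < (\<integral>\<^sup>+s\<in>{t-h..t}. v s \<partial>lborel)"
proof -
  obtain h where h: "0 < h" "ennreal l < (\<integral>\<^sup>+s\<in>{t-h..t}. v s \<partial>lborel) / ennreal h"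
    using assms unfolding left_maximal_def less_SUP_iff by auto
  have "ennreal (l * h) < (\<integral>\<^sup>+s\<in>{t-h..t}. v s \<partial>lborel)"
  proof (rule ccontr)
    assume "\<not> ?thesis"
    then have "(\<integral>\<^sup>+s\<in>{t-h..t}. v s \<partial>lborel) / ennreal h \<le> ennreal (l * h) / ennreal h"
      by (intro divide_right_mono_ennreal) auto
    also have "\<dots> = ennreal l" using h assms by (simp add: divide_ennreal)
    finally show False using h by auto
  qed
  with h show ?thesis by auto
qed

lemma nn_integral_le_left_maximal:
  assumes h: "0 < h"
  shows "(\<integral>\<^sup>+s\<in>{t-h..t}. v s \<partial>lborel) \<le> ennreal h * left_maximal v t"
proof -
  have rat: "(\<integral>\<^sup>+s\<in>{t-k..t}. v s \<partial>lborel) \<le> ennreal k * left_maximal v t" if "k \<in> \<rat>" "0 < k" for k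
  proof -
    let ?I = "\<integral>\<^sup>+s\<in>{t-k..t}. v s \<partial>lborel"
    have "?I / ennreal k \<le> left_maximal v t"
      unfolding left_maximal_def using that by (intro SUP_upper) auto
    then have "ennreal k * (?I / ennreal k) \<le> ennreal k * left_maximal v t"
      by (rule mult_left_mono) simp
    also have "ennreal k * (?I / ennreal k) = ?I"
      using that mult_divide_eq_ennreal[of "ennreal k" ?I]
      by (simp add: ennreal_times_divide mult.commute[of "ennreal k"])
    finally show ?thesis .
  qed
  show ?thesis
  proof (cases "left_maximal v t")
    case (real m)
    show ?thesis
    proof (rule ennreal_le_epsilon)
      fix e :: real assume e: "0 < e"
      have "h < h + e / (m + 1)" using e real by simp
      then obtain k where k: "k \<in> \<rat>" "h < k" "k < h + e / (m + 1)"
        using Rats_dense_in_real by blast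
      have km: "k * m \<le> h * m + e"
      proof -
        have "k * m \<le> (h + e / (m + 1)) * m" using k real by (intro mult_right_mono) auto
        also have "\<dots> = h * m + e * (m / (m + 1))" by (simp add: algebra_simps)
        also have "e * (m / (m + 1)) \<le> e * 1" using e real by (intro mult_left_mono) auto
        finally show ?thesis by simp
      qed
      have "(\<integral>\<^sup>+s\<in>{t-h..t}. v s \<partial>lborel) \<le> (\<integral>\<^sup>+s\<in>{t-k..t}. v s \<partial>lborel)"
        using k by (intro nn_integral_mono) (auto split: split_indicator)
      also have "\<dots> \<le> ennreal k * ennreal m" using rat[of k] k h real by simp
      also have "\<dots> = ennreal (k * m)" using k h real by (simp add: ennreal_mult)
      also have "\<dots> \<le> ennreal (h * m + e)" using km by (rule ennreal_leI)
      also have "\<dots> = ennreal h * left_maximal v t + ennreal e"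
        using h real e by (simp add: ennreal_mult)
      finally show "(\<integral>\<^sup>+s\<in>{t-h..t}. v s \<partial>lborel) \<le> ennreal h * left_maximal v t + ennreal e" .
    qed
  qed (use h in \<open>auto simp: ennreal_mult_top\<close>)
qed

text \<open>The layer-cake formula for powers: \<open>x powr b\<close> as an integral over the levels below \<open>x\<close>.\<close>

lemma nn_integral_powr_layer:
  assumes b: "0 < b" and x: "0 \<le> (x::real)"
  shows "(\<integral>\<^sup>+l. ennreal (l powr (b - 1)) * indicator {0<..<x} l \<partial>lborel) = ennreal (x powr b / b)"
proof -
  have "((\<lambda>l. l powr (b - 1)) has_integral (x powr b / b)) {0..x}"
    using has_integral_powr_from_0[of "b - 1" x] b x by simp
  from nn_integral_has_integral_lebesgue'[OF _ this]
  have "(\<integral>\<^sup>+l. ennreal (l powr (b - 1)) * indicator {0..x} l \<partial>lborel) = ennreal (x powr b / b)" by simp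
  moreover have "(\<integral>\<^sup>+l. ennreal (l powr (b - 1)) * indicator {0..x} l \<partial>lborel)
     = (\<integral>\<^sup>+l. ennreal (l powr (b - 1)) * indicator {0<..<x} l \<partial>lborel)"
    using AE_lborel_singleton[of 0] AE_lborel_singleton[of x]
    by (intro nn_integral_cong_AE) (auto elim!: eventually_elim2 split: split_indicator)
  ultimately show ?thesis by simp
qed

text \<open>The maximal theorem in \<open>L\<^sub>q\<close>, \<open>q > 1\<close>, in its Marcinkiewicz form: at level \<open>l\<close> the weak type
  inequality is applied only to the part of \<open>u\<close> that exceeds \<open>l / 2\<close>, since the rest contributes at
  most \<open>l / 2\<close> to every average; integrating the result over the levels with weight
  \<open>q * l powr (q - 1)\<close> gives the claim.\<close>

theorem left_maximal_strong_type:
  fixes u :: "real \<Rightarrow> real" and q :: real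
  assumes u[measurable]: "u \<in> borel_measurable borel" and u0: "\<And>s. 0 \<le> u s" and q: "1 < q"
    and fin: "(\<integral>\<^sup>+s. u s \<partial>lborel) < \<infinity>"
  shows "AE t in lborel. left_maximal u t < \<infinity>"
    and "(\<integral>\<^sup>+t. ennreal (enn2real (left_maximal u t) powr q) \<partial>lborel)
          \<le> ennreal (10 * q * 2 powr (q - 1) / (q - 1)) * (\<integral>\<^sup>+s. ennreal (u s powr q) \<partial>lborel)"
proof -
  let ?M = "left_maximal (\<lambda>s. ennreal (u s))"
  define m where "m t = enn2real (?M t)" for t
  have m[measurable]: "m \<in> borel_measurable borel" unfolding m_def by measurable
  have m0: "0 \<le> m t" for t by (simp add: m_def)
  have weak: "ennreal l * emeasure lborel {t. ?M t = \<infinity>} \<le> 5 * (\<integral>\<^sup>+s. u s \<partial>lborel)" if "0 < l" for l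
    using that fin by (intro left_average_weak_type) (auto intro!: less_left_maximal simp: less_top[symmetric])
  have "emeasure lborel {t. ?M t = \<infinity>} = 0"
  proof (rule ccontr)
    assume n: "emeasure lborel {t. ?M t = \<infinity>} \<noteq> 0"
    let ?e = "emeasure lborel {t. ?M t = \<infinity>}"
    obtain c where c: "5 * (\<integral>\<^sup>+s. u s \<partial>lborel) = ennreal c" "0 \<le> c"
      using fin by (cases "5 * (\<integral>\<^sup>+s. u s \<partial>lborel)") (auto simp: ennreal_mult_eq_top_iff)
    have "?e \<noteq> \<infinity>" using weak[of 1] c by (auto simp: top_unique)
    then obtain e where e: "?e = ennreal e" "0 < e" using n by (cases ?e) auto
    have "(c + 1) / e * e \<le> c"
      using weak[of "(c+1)/e"] c e by (simp add: ennreal_mult[symmetric] del: times_divide_eq_left)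
    then show False using e by simp
  qed
  then show "AE t in lborel. ?M t < \<infinity>"
    by (intro AE_I[of _ _ "{t. ?M t = \<infinity>}"]) (auto simp: less_top[symmetric])
  \<comment> \<open>The value of \<open>enn2real\<close> at infinity is 0, so the levels of \<open>m\<close> lie inside those of the maximal function.\<close>
  have level: "ennreal (l / 2) * emeasure lborel {t. l < m t}
      \<le> 5 * (\<integral>\<^sup>+s. ennreal (u s) * indicator {s. l < 2 * u s} s \<partial>lborel)" if l: "0 < l" for l
  proof (rule left_average_weak_type)
    show "(\<integral>\<^sup>+s. ennreal (u s) * indicator {s. l < 2 * u s} s \<partial>lborel) < \<infinity>"
      by (rule le_less_trans[OF nn_integral_mono fin]) (auto split: split_indicator)
    fix t assume "t \<in> {t. l < m t}"
    then have "ennreal l < ?M t" using l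
      by (cases "?M t") (auto simp: m_def ennreal_less_iff)
    from less_left_maximal[OF this] l obtain h where
      h: "0 < h" "ennreal (l * h) < (\<integral>\<^sup>+s\<in>{t-h..t}. u s \<partial>lborel)" by auto
    have "(\<integral>\<^sup>+s\<in>{t-h..t}. u s \<partial>lborel) \<le>
      (\<integral>\<^sup>+s. ennreal (u s) * indicator {s. l < 2 * u s} s * indicator {t-h..t} s
         + ennreal (l / 2) * indicator {t-h..t} s \<partial>lborel)"
      using l by (intro nn_integral_mono) (auto split: split_indicator intro!: ennreal_leI)
    also have "\<dots> = (\<integral>\<^sup>+s\<in>{t-h..t}. ennreal (u s) * indicator {s. l < 2 * u s} s \<partial>lborel) + ennreal (l / 2 * h)"
      using l h by (subst nn_integral_add) (auto simp: nn_integral_cmult ennreal_mult[symmetric])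
    finally have "ennreal (l * h) < (\<integral>\<^sup>+s\<in>{t-h..t}. ennreal (u s) * indicator {s. l < 2 * u s} s \<partial>lborel) + ennreal (l / 2 * h)"
      using h by simp
    moreover have "ennreal (l * h) = ennreal (l / 2 * h) + ennreal (l / 2 * h)"
      using l h by (simp flip: ennreal_plus add: field_simps)
    ultimately have "ennreal (l / 2 * h) < (\<integral>\<^sup>+s\<in>{t-h..t}. ennreal (u s) * indicator {s. l < 2 * u s} s \<partial>lborel)"
      by (metis add_right_mono leD leI)
    then show "\<exists>h>0. ennreal (l / 2 * h) < (\<integral>\<^sup>+s\<in>{t-h..t}. ennreal (u s) * indicator {s. l < 2 * u s} s \<partial>lborel)"
      using h by blast
  qed (use l in auto)
  have "(\<integral>\<^sup>+t. ennreal (m t powr q) \<partial>lborel)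
     = (\<integral>\<^sup>+t. (\<integral>\<^sup>+l. ennreal (q * l powr (q - 1)) * indicator {x::real\<times>real. 0 < snd x \<and> snd x < m (fst x)} (t, l) \<partial>lborel) \<partial>lborel)"
  proof (rule nn_integral_cong)
    fix t
    have "(\<integral>\<^sup>+l. ennreal (q * l powr (q - 1)) * indicator {x::real\<times>real. 0 < snd x \<and> snd x < m (fst x)} (t, l) \<partial>lborel)
      = (\<integral>\<^sup>+l. ennreal q * (ennreal (l powr (q - 1)) * indicator {0<..<m t} l) \<partial>lborel)"
      using q by (intro nn_integral_cong) (auto split: split_indicator simp: ennreal_mult)
    also have "\<dots> = ennreal q * ennreal (m t powr q / q)"
      using q m0 by (subst nn_integral_cmult) (auto simp: nn_integral_powr_layer)
    also have "\<dots> = ennreal (m t powr q)" using q by (simp add: ennreal_mult[symmetric])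
    finally show "ennreal (m t powr q) = (\<integral>\<^sup>+l. ennreal (q * l powr (q - 1)) * indicator {x::real\<times>real. 0 < snd x \<and> snd x < m (fst x)} (t, l) \<partial>lborel)" ..
  qed
  also have "\<dots> = (\<integral>\<^sup>+l. (\<integral>\<^sup>+t. ennreal (q * l powr (q - 1)) * indicator {x::real\<times>real. 0 < snd x \<and> snd x < m (fst x)} (t, l) \<partial>lborel) \<partial>lborel)"
    by (rule lborel_pair.Fubini') measurable
  also have "\<dots> \<le> (\<integral>\<^sup>+l. (\<integral>\<^sup>+s. ennreal (10 * q * l powr (q - 2) * u s) * indicator {x::real\<times>real. 0 < snd x \<and> snd x < 2 * u (fst x)} (s, l) \<partial>lborel) \<partial>lborel)"
  proof (rule nn_integral_mono)
    fix l :: real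
    show "(\<integral>\<^sup>+t. ennreal (q * l powr (q - 1)) * indicator {x::real\<times>real. 0 < snd x \<and> snd x < m (fst x)} (t, l) \<partial>lborel)
      \<le> (\<integral>\<^sup>+s. ennreal (10 * q * l powr (q - 2) * u s) * indicator {x::real\<times>real. 0 < snd x \<and> snd x < 2 * u (fst x)} (s, l) \<partial>lborel)"
    proof (cases "0 < l")
      case True
      have pw: "q * l powr (q - 1) = 2 * q * l powr (q - 2) * (l / 2)"
        using True by (simp add: powr_diff power2_eq_square)
      have "(\<integral>\<^sup>+t. ennreal (q * l powr (q - 1)) * indicator {x::real\<times>real. 0 < snd x \<and> snd x < m (fst x)} (t, l) \<partial>lborel)
        = (\<integral>\<^sup>+t. ennreal (q * l powr (q - 1)) * indicator {t. l < m t} t \<partial>lborel)"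
        using True by (intro nn_integral_cong) (auto split: split_indicator)
      also have "\<dots> = ennreal (q * l powr (q - 1)) * emeasure lborel {t. l < m t}"
        by (subst nn_integral_cmult_indicator) auto
      also have "\<dots> = ennreal (2 * q * l powr (q - 2)) * (ennreal (l / 2) * emeasure lborel {t. l < m t})"
        unfolding pw using True q by (subst ennreal_mult) (auto simp: mult.assoc)
      also have "\<dots> \<le> ennreal (2 * q * l powr (q - 2)) * (5 * (\<integral>\<^sup>+s. ennreal (u s) * indicator {s. l < 2 * u s} s \<partial>lborel))"
        by (rule mult_left_mono[OF level[OF True]]) simp
      also have "\<dots> = ennreal (10 * q * l powr (q - 2)) * (\<integral>\<^sup>+s. ennreal (u s) * indicator {s. l < 2 * u s} s \<partial>lborel)"
      proof -
        have "ennreal (10 * q * l powr (q - 2)) = ennreal (2 * q * l powr (q - 2)) * ennreal 5"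
          using q by (subst ennreal_mult[symmetric]) auto
        then show ?thesis by (simp add: mult.assoc)
      qed
      also have "\<dots> = (\<integral>\<^sup>+s. ennreal (10 * q * l powr (q - 2) * u s) * indicator {x::real\<times>real. 0 < snd x \<and> snd x < 2 * u (fst x)} (s, l) \<partial>lborel)"
        using True q u0 by (subst nn_integral_cmult[symmetric])
          (auto intro!: nn_integral_cong split: split_indicator simp: ennreal_mult)
      finally show ?thesis .
    qed (auto simp: indicator_def)
  qed
  also have "\<dots> = (\<integral>\<^sup>+s. (\<integral>\<^sup>+l. ennreal (10 * q * l powr (q - 2) * u s) * indicator {x::real\<times>real. 0 < snd x \<and> snd x < 2 * u (fst x)} (s, l) \<partial>lborel) \<partial>lborel)"
    by (rule lborel_pair.Fubini') measurable
  also have "\<dots> = (\<integral>\<^sup>+s. ennreal (10 * q * 2 powr (q - 1) / (q - 1)) * ennreal (u s powr q) \<partial>lborel)"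
  proof (rule nn_integral_cong)
    fix s
    have "(\<integral>\<^sup>+l. ennreal (10 * q * l powr (q - 2) * u s) * indicator {x::real\<times>real. 0 < snd x \<and> snd x < 2 * u (fst x)} (s, l) \<partial>lborel)
      = (\<integral>\<^sup>+l. ennreal (10 * q * u s) * (ennreal (l powr ((q - 1) - 1)) * indicator {0<..<2 * u s} l) \<partial>lborel)"
      using q u0[of s] by (intro nn_integral_cong) (auto split: split_indicator simp: ennreal_mult[symmetric] mult_ac)
    also have "\<dots> = ennreal (10 * q * u s) * ennreal ((2 * u s) powr (q - 1) / (q - 1))"
      using q u0[of s] nn_integral_powr_layer[of "q - 1" "2 * u s"] by (subst nn_integral_cmult) auto
    also have "\<dots> = ennreal (10 * q * 2 powr (q - 1) / (q - 1) * u s powr q)"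
    proof -
      have "u s * u s powr (q - 1) = u s powr q"
        using u0[of s] by (cases "u s = 0") (auto simp: powr_diff)
      then have "10 * q * u s * ((2 * u s) powr (q - 1) / (q - 1)) = 10 * q * 2 powr (q - 1) / (q - 1) * u s powr q"
        by (simp add: powr_mult mult_ac)
      then show ?thesis using q u0[of s] by (subst ennreal_mult[symmetric]) auto
    qed
    finally show "(\<integral>\<^sup>+l. ennreal (10 * q * l powr (q - 2) * u s) * indicator {x::real\<times>real. 0 < snd x \<and> snd x < 2 * u (fst x)} (s, l) \<partial>lborel)
       = ennreal (10 * q * 2 powr (q - 1) / (q - 1)) * ennreal (u s powr q)"
      using q by (simp add: ennreal_mult[symmetric])
  qed
  also have "\<dots> = ennreal (10 * q * 2 powr (q - 1) / (q - 1)) * (\<integral>\<^sup>+s. ennreal (u s powr q) \<partial>lborel)"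
    by (rule nn_integral_cmult) measurable
  finally show "(\<integral>\<^sup>+t. ennreal (enn2real (?M t) powr q) \<partial>lborel)
          \<le> ennreal (10 * q * 2 powr (q - 1) / (q - 1)) * (\<integral>\<^sup>+s. ennreal (u s powr q) \<partial>lborel)"
    unfolding m_def .
qed

section \<open>The spaces Lp on the unit interval\<close>

lemma emeasure_unit_meas [simp]: "emeasure unit_meas {0..1} = 1" "emeasure unit_meas (space unit_meas) = 1"
  by (simp_all add: emeasure_restrict_space space_restrict_space)

text \<open>A description of the balls of \<open>L\<^sub>p\<close> that treats finite and infinite \<open>p\<close> alike: membership and the
  norm bound together are one inequality, free of integrability conditions.\<close>

lemma Lp_norm_le_iff:
  assumes p: "1 < p" and f[measurable]: "f \<in> borel_measurable unit_meas" and C: "0 \<le> C"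
  shows "f \<in> Lp_functions p \<and> Lp_norm p f \<le> C \<longleftrightarrow>
    (if p = \<infinity> then (AE t in unit_meas. \<bar>f t\<bar> \<le> C)
     else (\<integral>\<^sup>+t. ennreal (\<bar>f t\<bar> powr enn2real p) \<partial>unit_meas) \<le> ennreal (C powr enn2real p))"
proof (cases "p = \<infinity>")
  case True
  let ?e = "esssup unit_meas (\<lambda>t. ennreal \<bar>f t\<bar>)"
  have "f \<in> Lp_functions p \<and> Lp_norm p f \<le> C \<longleftrightarrow> ?e < \<infinity> \<and> enn2real ?e \<le> C"
    using True f by (simp add: Lp_functions_def Lp_norm_def)
  also have "\<dots> \<longleftrightarrow> ?e \<le> ennreal C"
    using C by (cases ?e) (auto simp: less_top[symmetric] top_unique)
  also have "\<dots> \<longleftrightarrow> (AE t in unit_meas. ennreal \<bar>f t\<bar> \<le> ennreal C)"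
  proof
    assume "?e \<le> ennreal C"
    then show "AE t in unit_meas. ennreal \<bar>f t\<bar> \<le> ennreal C"
      using esssup_AE[of "\<lambda>t. ennreal \<bar>f t\<bar>" unit_meas] by (auto elim: eventually_mono)
  qed (rule esssup_I, measurable)
  also have "\<dots> \<longleftrightarrow> (AE t in unit_meas. \<bar>f t\<bar> \<le> C)" using C by simp
  finally show ?thesis using True by simp
next
  case False
  define q where "q = enn2real p"
  have q: "1 \<le> q" using enn2real_ge_1[OF p False] by (simp add: q_def)
  let ?I = "\<integral>\<^sup>+t. ennreal (\<bar>f t\<bar> powr q) \<partial>unit_meas"
  have "?I \<le> ennreal (C powr q)" if "f \<in> Lp_functions p" "Lp_norm p f \<le> C"
  proof -
    have i: "integrable unit_meas (\<lambda>t. \<bar>f t\<bar> powr q)"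
      using that False by (simp add: Lp_functions_def q_def)
    let ?L = "LINT t|unit_meas. \<bar>f t\<bar> powr q"
    have L: "0 \<le> ?L" by simp
    have "?L = (?L powr (1 / q)) powr q" using L q by (simp add: powr_powr)
    also have "\<dots> \<le> C powr q"
      using that(2) False q by (intro powr_mono2) (auto simp: Lp_norm_def q_def)
    finally show ?thesis using nn_integral_eq_integral[OF i] by (auto intro: ennreal_leI)
  qed
  moreover have "f \<in> Lp_functions p \<and> Lp_norm p f \<le> C" if I: "?I \<le> ennreal (C powr q)"
  proof
    have i: "integrable unit_meas (\<lambda>t. \<bar>f t\<bar> powr q)"
      using le_less_trans[OF I] by (intro integrableI_nonneg) auto
    then show "f \<in> Lp_functions p" using False by (simp add: Lp_functions_def q_def)
    have "(LINT t|unit_meas. \<bar>f t\<bar> powr q) \<le> C powr q"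
      using I nn_integral_eq_integral[OF i] by (auto simp: ennreal_le_iff)
    then have "(LINT t|unit_meas. \<bar>f t\<bar> powr q) powr (1 / q) \<le> (C powr q) powr (1 / q)"
      using q by (intro powr_mono2) auto
    then show "Lp_norm p f \<le> C" using False q C by (simp add: Lp_norm_def q_def powr_powr)
  qed
  ultimately show ?thesis using False unfolding q_def by auto
qed

lemma Lp_measurable [measurable_dest]: "f \<in> Lp_functions p \<Longrightarrow> f \<in> borel_measurable unit_meas"
  by (simp add: Lp_functions_def)

lemma Lp_dominated:
  assumes p: "1 < p" and f: "f \<in> borel_measurable unit_meas" and g: "g \<in> Lp_functions p"
    and le: "AE t in unit_meas. \<bar>f t\<bar> \<le> \<bar>g t\<bar>"
  shows "f \<in> Lp_functions p" "Lp_norm p f \<le> Lp_norm p g"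
proof -
  have g': "g \<in> borel_measurable unit_meas" using g by (rule Lp_measurable)
  note * = Lp_norm_le_iff[OF p g' Lp_norm_nonneg, of p g, THEN iffD1, OF conjI[OF g order_refl]]
  have "f \<in> Lp_functions p \<and> Lp_norm p f \<le> Lp_norm p g"
  proof (cases "p = \<infinity>")
    case True
    then show ?thesis using * le
      by (subst Lp_norm_le_iff[OF p f Lp_norm_nonneg]) (auto elim: eventually_elim2)
  next
    case False
    have "(\<integral>\<^sup>+t. ennreal (\<bar>f t\<bar> powr enn2real p) \<partial>unit_meas) \<le> (\<integral>\<^sup>+t. ennreal (\<bar>g t\<bar> powr enn2real p) \<partial>unit_meas)"
      using le by (intro nn_integral_mono_AE) (auto elim!: eventually_mono intro!: ennreal_leI powr_mono2)
    with False * show ?thesis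
      by (subst Lp_norm_le_iff[OF p f Lp_norm_nonneg]) auto
  qed
  then show "f \<in> Lp_functions p" "Lp_norm p f \<le> Lp_norm p g" by auto
qed

lemma Lp_norm_cong_AE:
  assumes p: "1 < p" and f: "f \<in> Lp_functions p" and g: "g \<in> Lp_functions p"
    and eq: "AE t in unit_meas. f t = g t"
  shows "Lp_norm p f = Lp_norm p g"
proof (rule antisym)
  have "AE t in unit_meas. \<bar>f t\<bar> \<le> \<bar>g t\<bar>" using eq by eventually_elim simp
  then show "Lp_norm p f \<le> Lp_norm p g" by (rule Lp_dominated(2)[OF p Lp_measurable[OF f] g])
  have "AE t in unit_meas. \<bar>g t\<bar> \<le> \<bar>f t\<bar>" using eq by eventually_elim simp
  then show "Lp_norm p g \<le> Lp_norm p f" by (rule Lp_dominated(2)[OF p Lp_measurable[OF g] f])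
qed

lemma Lp_scale:
  assumes p: "1 < p" and f: "f \<in> Lp_functions p"
  shows "(\<lambda>t. c * f t) \<in> Lp_functions p" "Lp_norm p (\<lambda>t. c * f t) \<le> \<bar>c\<bar> * Lp_norm p f"
proof -
  have [measurable]: "f \<in> borel_measurable unit_meas" using f by (rule Lp_measurable)
  note * = Lp_norm_le_iff[OF p _ Lp_norm_nonneg, of f p f, THEN iffD1, OF _ conjI[OF f order_refl]]
  have "(\<lambda>t. c * f t) \<in> Lp_functions p \<and> Lp_norm p (\<lambda>t. c * f t) \<le> \<bar>c\<bar> * Lp_norm p f"
  proof (subst Lp_norm_le_iff[OF p])
    show "if p = \<infinity> then AE t in unit_meas. \<bar>c * f t\<bar> \<le> \<bar>c\<bar> * Lp_norm p f
      else (\<integral>\<^sup>+t. ennreal (\<bar>c * f t\<bar> powr enn2real p) \<partial>unit_meas) \<le> ennreal ((\<bar>c\<bar> * Lp_norm p f) powr enn2real p)"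
      using * by (auto simp: abs_mult powr_mult ennreal_mult nn_integral_cmult
          intro!: mult_left_mono elim!: eventually_mono)
  qed (auto simp: Lp_norm_nonneg)
  then show "(\<lambda>t. c * f t) \<in> Lp_functions p" "Lp_norm p (\<lambda>t. c * f t) \<le> \<bar>c\<bar> * Lp_norm p f" by auto
qed

lemma Lp_norm_le_bound:
  assumes p: "1 < p" and f: "f \<in> borel_measurable unit_meas" and C: "0 \<le> C"
    and le: "AE t in unit_meas. \<bar>f t\<bar> \<le> C"
  shows "f \<in> Lp_functions p" "Lp_norm p f \<le> C"
proof -
  have "(\<integral>\<^sup>+t. ennreal (\<bar>f t\<bar> powr enn2real p) \<partial>unit_meas) \<le> (\<integral>\<^sup>+t. ennreal (C powr enn2real p) \<partial>unit_meas)"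
    using le by (intro nn_integral_mono_AE) (auto elim!: eventually_mono intro!: ennreal_leI powr_mono2)
  then have "f \<in> Lp_functions p \<and> Lp_norm p f \<le> C"
    using le by (subst Lp_norm_le_iff[OF p f C]) (auto simp: nn_integral_const)
  then show "f \<in> Lp_functions p" "Lp_norm p f \<le> C" by auto
qed

text \<open>The \<open>L\<^sub>1\<close> norm is controlled by the \<open>L\<^sub>p\<close> norm.  The factor 2 is not sharp (Hoelder's inequality would give 1)
  but comes from the elementary bound \<open>x \<le> C + C powr (1 - q) * x powr q\<close>.\<close>

lemma nn_integral_abs_le_Lp_norm:
  assumes p: "1 < p" and f: "f \<in> Lp_functions p" and C: "Lp_norm p f \<le> C" "0 < C"
  shows "(\<integral>\<^sup>+t. ennreal \<bar>f t\<bar> \<partial>unit_meas) \<le> ennreal (2 * C)"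
proof -
  have f'[measurable]: "f \<in> borel_measurable unit_meas" using f by (rule Lp_measurable)
  note * = Lp_norm_le_iff[OF p f' less_imp_le[OF C(2)], THEN iffD1, OF conjI[OF f C(1)]]
  show ?thesis
  proof (cases "p = \<infinity>")
    case True
    with * have "AE t in unit_meas. \<bar>f t\<bar> \<le> C" by simp
    then have "AE t in unit_meas. ennreal \<bar>f t\<bar> \<le> ennreal (2 * C)"
      by eventually_elim (use C(2) in \<open>auto intro!: ennreal_leI\<close>)
    then have "(\<integral>\<^sup>+t. ennreal \<bar>f t\<bar> \<partial>unit_meas) \<le> (\<integral>\<^sup>+t. ennreal (2 * C) \<partial>unit_meas)"
      by (rule nn_integral_mono_AE)
    then show ?thesis by (simp add: nn_integral_const)
  next
    case False
    define q where "q = enn2real p"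
    have q: "1 \<le> q" using enn2real_ge_1[OF p False] by (simp add: q_def)
    have pw: "x \<le> C + C powr (1 - q) * x powr q" if "0 \<le> x" for x
    proof (cases "x \<le> C")
      case True
      moreover have "0 \<le> C powr (1 - q) * x powr q" by simp
      ultimately show ?thesis by linarith
    next
      case False
      have xC: "1 \<le> x / C" using False C by simp
      have "x / C = (x / C) powr 1" using xC by (intro powr_one[symmetric]) simp
      also have "\<dots> \<le> (x / C) powr q" using q xC by (rule powr_mono)
      finally have "x / C \<le> (x / C) powr q" .
      then have "C * (x / C) \<le> C * (x / C) powr q" using C(2) by (intro mult_left_mono) auto
      moreover have "C * (x / C) powr q = C powr (1 - q) * x powr q"
        using C(2) by (simp only: powr_divide powr_diff powr_one) simp
      moreover have "C * (x / C) = x" using C(2) by simp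
      ultimately show ?thesis using C(2) by linarith
    qed
    have "(\<integral>\<^sup>+t. ennreal \<bar>f t\<bar> \<partial>unit_meas) \<le> (\<integral>\<^sup>+t. ennreal C + ennreal (C powr (1 - q)) * ennreal (\<bar>f t\<bar> powr q) \<partial>unit_meas)"
    proof (rule nn_integral_mono)
      fix t
      have "ennreal \<bar>f t\<bar> \<le> ennreal (C + C powr (1 - q) * \<bar>f t\<bar> powr q)"
        by (intro ennreal_leI pw) simp
      also have "\<dots> = ennreal C + ennreal (C powr (1 - q)) * ennreal (\<bar>f t\<bar> powr q)"
        using C by (simp add: ennreal_mult)
      finally show "ennreal \<bar>f t\<bar> \<le> ennreal C + ennreal (C powr (1 - q)) * ennreal (\<bar>f t\<bar> powr q)" .
    qed
    also have "\<dots> = ennreal C + ennreal (C powr (1 - q)) * (\<integral>\<^sup>+t. ennreal (\<bar>f t\<bar> powr q) \<partial>unit_meas)"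
      by (subst nn_integral_add) (auto simp: nn_integral_cmult nn_integral_const)
    also have "\<dots> \<le> ennreal C + ennreal (C powr (1 - q)) * ennreal (C powr q)"
      using * False by (intro add_mono mult_left_mono) (auto simp: q_def)
    also have "ennreal (C powr (1 - q)) * ennreal (C powr q) = ennreal C"
      using C by (simp add: ennreal_mult[symmetric] powr_add[symmetric])
    also have "ennreal C + ennreal C = ennreal (2 * C)"
      using C by (simp add: ennreal_plus[symmetric] del: ennreal_plus)
    finally show ?thesis .
  qed
qed

lemma Lp_Fatou:
  assumes p: "1 < p" and f[measurable]: "f \<in> borel_measurable unit_meas" and C: "0 \<le> C"
    and g: "\<And>n. g n \<in> Lp_functions p" and gC: "\<And>n. Lp_norm p (g n) \<le> C"
    and lim: "AE t in unit_meas. (\<lambda>n. g n t) \<longlonglongrightarrow> f t"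
  shows "f \<in> Lp_functions p" "Lp_norm p f \<le> C"
proof -
  have [measurable]: "g n \<in> borel_measurable unit_meas" for n using g by (rule Lp_measurable)
  note * = Lp_norm_le_iff[OF p _ C, THEN iffD1, OF _ conjI[OF g gC]]
  have "f \<in> Lp_functions p \<and> Lp_norm p f \<le> C"
  proof (cases "p = \<infinity>")
    case True
    have "AE t in unit_meas. \<forall>n. \<bar>g n t\<bar> \<le> C" using * True by (auto simp: AE_all_countable)
    with lim have "AE t in unit_meas. \<bar>f t\<bar> \<le> C"
    proof eventually_elim
      case (elim t)
      then show ?case by (intro LIMSEQ_le_const2[OF tendsto_rabs[OF elim(1)]]) auto
    qed
    then show ?thesis using True by (subst Lp_norm_le_iff[OF p f C]) auto
  next
    case False
    have q: "1 \<le> enn2real p" using enn2real_ge_1[OF p False] .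
    have "AE t in unit_meas. ennreal (\<bar>f t\<bar> powr enn2real p) = liminf (\<lambda>n. ennreal (\<bar>g n t\<bar> powr enn2real p))"
      using lim
    proof eventually_elim
      case (elim t)
      have "(\<lambda>n. ennreal (\<bar>g n t\<bar> powr enn2real p)) \<longlonglongrightarrow> ennreal (\<bar>f t\<bar> powr enn2real p)"
        using q elim by (intro tendsto_ennrealI tendsto_powr' tendsto_rabs tendsto_const) auto
      from lim_imp_Liminf[OF _ this] show ?case by simp
    qed
    then have "(\<integral>\<^sup>+t. ennreal (\<bar>f t\<bar> powr enn2real p) \<partial>unit_meas)
        = (\<integral>\<^sup>+t. liminf (\<lambda>n. ennreal (\<bar>g n t\<bar> powr enn2real p)) \<partial>unit_meas)"
      by (rule nn_integral_cong_AE)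
    also have "\<dots> \<le> liminf (\<lambda>n. \<integral>\<^sup>+t. ennreal (\<bar>g n t\<bar> powr enn2real p) \<partial>unit_meas)"
      by (rule nn_integral_liminf) measurable
    also have "\<dots> \<le> liminf (\<lambda>n. ennreal (C powr enn2real p))"
      using * False by (intro Liminf_mono always_eventually) auto
    also have "\<dots> = ennreal (C powr enn2real p)" by (simp add: Liminf_const)
    finally show ?thesis using False by (subst Lp_norm_le_iff[OF p f C]) auto
  qed
  then show "f \<in> Lp_functions p" "Lp_norm p f \<le> C" by auto
qed

lemma Lp_class_in_space: "f \<in> Lp_functions p \<Longrightarrow> Lp_class p f \<in> Lp_space p"
  unfolding Lp_class_def Lp_space_def by (rule quotientI)

lemma Lp_class_rep:
  assumes "f \<in> Lp_functions p"
  shows "(SOME g. g \<in> Lp_class p f) \<in> Lp_functions p"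
    and "AE t in unit_meas. f t = (SOME g. g \<in> Lp_class p f) t"
  using Lp_rep[OF Lp_class_in_space[OF assms]] by (auto simp: Lp_class_def AE_rel_def)

lemma Lp_class_of_rep: "X \<in> Lp_space p \<Longrightarrow> Lp_class p (SOME f. f \<in> X) = X"
  using Lp_rep[of X p] equiv_AE_rel[of p] unfolding Lp_space_def Lp_class_def
  by (meson Image_singleton_iff equiv_class_eq_iff equiv_class_self quotientI quotient_eqI)

lemma Lp_dist_class:
  assumes p: "1 < p" and f: "f \<in> Lp_functions p" and g: "g \<in> Lp_functions p"
  shows "Lp_dist p (Lp_class p f) (Lp_class p g) = Lp_norm p (\<lambda>t. f t - g t)"
  unfolding Lp_dist_def
proof (intro Lp_norm_cong_AE Lp_diff p f g Lp_class_rep)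
  show "AE t in unit_meas. (SOME h. h \<in> Lp_class p f) t - (SOME h. h \<in> Lp_class p g) t = f t - g t"
    using Lp_class_rep(2)[OF f] Lp_class_rep(2)[OF g] by eventually_elim simp
qed

text \<open>Riesz--Fischer: a rapidly convergent subsequence converges almost everywhere, because its
  increments are absolutely summable in \<open>L\<^sub>1\<close>, and Fatou's lemma turns pointwise into norm
  convergence.\<close>

theorem Lp_complete:
  assumes p: "1 < p"
  shows "Metric_space.mcomplete (Lp_space p) (Lp_dist p)"
proof -
  interpret Metric_space "Lp_space p" "Lp_dist p" by (rule Metric_space_Lp[OF p])
  show ?thesis
    unfolding mcomplete_def
  proof (intro allI impI)
    fix \<sigma> assume \<sigma>: "MCauchy \<sigma>"
    then have in_space: "\<sigma> n \<in> Lp_space p" for n by (auto simp: MCauchy_def)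
    define F where "F n = (SOME f. f \<in> \<sigma> n)" for n
    have F: "F n \<in> Lp_functions p" for n unfolding F_def by (rule Lp_rep(2)[OF in_space])
    have dF: "Lp_dist p (\<sigma> m) (\<sigma> n) = Lp_norm p (\<lambda>t. F m t - F n t)" for m n
      by (simp add: Lp_dist_def F_def)
    have "\<forall>k. \<exists>N. \<forall>m n. N \<le> m \<longrightarrow> N \<le> n \<longrightarrow> Lp_dist p (\<sigma> m) (\<sigma> n) < (1/2)^k"
      using \<sigma> unfolding MCauchy_def by (metis half_gt_zero_iff zero_less_one zero_less_power)
    then obtain N where N: "\<And>k m n. N k \<le> m \<Longrightarrow> N k \<le> n \<Longrightarrow> Lp_dist p (\<sigma> m) (\<sigma> n) < (1/2)^k"
      by metis
    define r where "r k = k + (\<Sum>i\<le>k. N i)" for k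
    have r: "strict_mono r" unfolding r_def by (rule strict_monoI_Suc) auto
    have Nr: "N k \<le> r m" if "k \<le> m" for k m
      using that member_le_sum[of k "{..m}" N] by (auto simp: r_def)
    define g where "g k = F (r k)" for k
    have g: "g k \<in> Lp_functions p" for k by (simp add: g_def F)
    have [measurable]: "g k \<in> borel_measurable unit_meas" for k using g by (rule Lp_measurable)
    have dg: "Lp_norm p (\<lambda>t. g m t - g k t) \<le> (1/2)^k" if "k \<le> m" for k m
      using N[of k "r m" "r k"] Nr[of k k] Nr[of k m] that by (simp add: dF g_def)
    have "(\<integral>\<^sup>+t. (\<Sum>k. ennreal \<bar>g (Suc k) t - g k t\<bar>) \<partial>unit_meas)
        = (\<Sum>k. \<integral>\<^sup>+t. ennreal \<bar>g (Suc k) t - g k t\<bar> \<partial>unit_meas)"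
      by (rule nn_integral_suminf) measurable
    also have "\<dots> \<le> (\<Sum>k. ennreal (2 * (1/2)^k))"
      using dg by (intro suminf_le nn_integral_abs_le_Lp_norm[OF p Lp_diff[OF p g g]]) auto
    also have "\<dots> = ennreal (\<Sum>k. 2 * (1/2)^k)"
      by (intro suminf_ennreal2 summable_mult summable_geometric) auto
    also have "\<dots> < \<infinity>" by simp
    finally have "AE t in unit_meas. (\<Sum>k. ennreal \<bar>g (Suc k) t - g k t\<bar>) \<noteq> \<infinity>"
      by (intro nn_integral_noteq_infinite) auto
    then have conv: "AE t in unit_meas. (\<lambda>n. g n t) \<longlonglongrightarrow> lim (\<lambda>n. g n t)"
    proof eventually_elim
      case (elim t)
      then have "summable (\<lambda>k. \<bar>g (Suc k) t - g k t\<bar>)"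
        by (intro summable_suminf_not_top) auto
      then have "summable (\<lambda>k. g (Suc k) t - g k t)" by (rule summable_rabs_cancel)
      then have "(\<lambda>n. (\<Sum>k<n. g (Suc k) t - g k t) + g 0 t) \<longlonglongrightarrow> suminf (\<lambda>k. g (Suc k) t - g k t) + g 0 t"
        by (intro tendsto_add summable_LIMSEQ tendsto_const)
      moreover have "(\<Sum>k<n. g (Suc k) t - g k t) = g n t - g 0 t" for n
        by (rule sum_lessThan_telescope)
      ultimately have "convergent (\<lambda>n. g n t)" by (auto simp: convergent_def)
      then show ?case by (simp add: convergent_LIMSEQ_iff)
    qed
    define f where "f t = lim (\<lambda>n. g n t)" for t
    have [measurable]: "f \<in> borel_measurable unit_meas" unfolding f_def by measurable
    have fg: "(\<lambda>t. f t - g k t) \<in> Lp_functions p" "Lp_norm p (\<lambda>t. f t - g k t) \<le> (1/2)^k" for k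
    proof -
      have "AE t in unit_meas. (\<lambda>m. g (m + k) t - g k t) \<longlonglongrightarrow> f t - g k t"
        using conv
      proof eventually_elim
        case (elim t)
        show ?case unfolding f_def by (intro tendsto_diff tendsto_const LIMSEQ_ignore_initial_segment elim)
      qed
      from Lp_Fatou[OF p _ _ _ _ this, of "(1/2)^k"] dg[of k] Lp_diff[OF p g g]
      show "(\<lambda>t. f t - g k t) \<in> Lp_functions p" "Lp_norm p (\<lambda>t. f t - g k t) \<le> (1/2)^k" by auto
    qed
    have f: "f \<in> Lp_functions p" using Lp_add(1)[OF p fg(1)[of 0] g[of 0]] by simp
    have "limitin mtopology (\<sigma> \<circ> r) (Lp_class p f) sequentially"
      unfolding limitin_metric
    proof (intro conjI allI impI)
      show "Lp_class p f \<in> Lp_space p" by (rule Lp_class_in_space[OF f])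
      fix e :: real assume e: "0 < e"
      have "\<forall>\<^sub>F k in sequentially. (1/2::real)^k < e"
        using e by (intro order_tendstoD(2)[OF LIMSEQ_realpow_zero]) auto
      then show "\<forall>\<^sub>F k in sequentially. (\<sigma> \<circ> r) k \<in> Lp_space p \<and> Lp_dist p ((\<sigma> \<circ> r) k) (Lp_class p f) < e"
      proof eventually_elim
        case (elim k)
        have "\<sigma> (r k) = Lp_class p (g k)" unfolding g_def F_def by (rule Lp_class_of_rep[OF in_space, symmetric])
        then have "Lp_dist p (\<sigma> (r k)) (Lp_class p f) = Lp_norm p (\<lambda>t. f t - g k t)"
          by (simp add: commute[of "Lp_class p (g k)"] Lp_dist_class[OF p f g])
        then show ?case using fg(2)[of k] elim in_space by simp
      qed
    qed
    from MCauchy_convergent_subsequence[OF \<sigma> r this]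
    show "\<exists>x. limitin mtopology \<sigma> x sequentially" by blast
  qed
qed

text \<open>Relative compactness by finite nets; the centres of the nets need not belong to \<open>S\<close>.\<close>

lemma Lp_relatively_compactI:
  assumes p: "1 < p" and S: "S \<subseteq> Lp_functions p"
    and net: "\<And>e. 0 < e \<Longrightarrow> \<exists>K. finite K \<and> K \<subseteq> Lp_functions p \<and> (\<forall>f\<in>S. \<exists>g\<in>K. Lp_norm p (\<lambda>t. f t - g t) \<le> e)"
  shows "compactin (Lp_topology p) (Lp_topology p closure_of (Lp_class p ` S))"
proof -
  interpret Metric_space "Lp_space p" "Lp_dist p" by (rule Metric_space_Lp[OF p])
  have "mtotally_bounded (Lp_class p ` S)"
    unfolding mtotally_bounded_def
  proof (intro allI impI)
    fix e :: real assume e: "0 < e"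
    obtain K where K: "finite K" "K \<subseteq> Lp_functions p" "\<And>f. f \<in> S \<Longrightarrow> \<exists>g\<in>K. Lp_norm p (\<lambda>t. f t - g t) \<le> e / 3"
      using net[of "e / 3"] e by auto
    let ?near = "\<lambda>g f. f \<in> S \<and> Lp_norm p (\<lambda>t. f t - g t) \<le> e / 3"
    \<comment> \<open>Each net point that is close to \<open>S\<close> is moved into \<open>S\<close>, at the price of doubling the radius.\<close>
    define s where "s g = (SOME f. ?near g f)" for g
    let ?K = "{g \<in> K. \<exists>f. ?near g f}"
    have s: "?near g (s g)" if "g \<in> ?K" for g using that someI_ex[of "?near g"] unfolding s_def by blast
    have "Lp_class p f \<in> (\<Union>g\<in>?K. mball (Lp_class p (s g)) e)" if f: "f \<in> S" for f
    proof -
      obtain g where g: "g \<in> K" "Lp_norm p (\<lambda>t. f t - g t) \<le> e / 3" using K(3)[OF f] by auto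
      then have gK: "g \<in> ?K" using f by auto
      have L: "f \<in> Lp_functions p" "g \<in> Lp_functions p" "s g \<in> Lp_functions p"
        using f g s[OF gK] S K by auto
      have "Lp_dist p (Lp_class p (s g)) (Lp_class p f)
          \<le> Lp_dist p (Lp_class p (s g)) (Lp_class p g) + Lp_dist p (Lp_class p g) (Lp_class p f)"
        using L by (intro triangle Lp_class_in_space)
      also have "Lp_dist p (Lp_class p g) (Lp_class p f) = Lp_norm p (\<lambda>t. f t - g t)"
        using L by (simp add: commute[of "Lp_class p g"] Lp_dist_class[OF p])
      also have "Lp_dist p (Lp_class p (s g)) (Lp_class p g) = Lp_norm p (\<lambda>t. s g t - g t)"
        using L by (simp add: Lp_dist_class[OF p])
      finally have "Lp_dist p (Lp_class p (s g)) (Lp_class p f) < e" using g s[OF gK] e by simp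
      then show ?thesis using gK L by (auto simp: Lp_class_in_space)
    qed
    then show "\<exists>K. finite K \<and> K \<subseteq> Lp_class p ` S \<and> Lp_class p ` S \<subseteq> (\<Union>x\<in>K. mball x e)"
      using K(1) s by (intro exI[of _ "(\<lambda>g. Lp_class p (s g)) ` ?K"]) auto
  qed
  then show ?thesis
    using mtotally_bounded_eq_compact_closure_of[OF Lp_complete[OF p]] by (simp add: Lp_topology_def)
qed

text \<open>A relatively compact set contains no infinite uniformly separated sequence.\<close>

lemma Lp_relatively_compactD:
  fixes f :: "nat \<Rightarrow> real \<Rightarrow> real"
  assumes p: "1 < p" and S: "S \<subseteq> Lp_functions p"
    and cpt: "compactin (Lp_topology p) (Lp_topology p closure_of (Lp_class p ` S))"
    and f: "\<And>n. f n \<in> S" and e: "0 < e"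
  shows "\<exists>m n. m < n \<and> Lp_norm p (\<lambda>t. f n t - f m t) < e"
proof -
  interpret Metric_space "Lp_space p" "Lp_dist p" by (rule Metric_space_Lp[OF p])
  have "Lp_class p ` S \<subseteq> Lp_space p" using S Lp_class_in_space by blast
  with cpt have "mtotally_bounded (Lp_class p ` S)"
    using mtotally_bounded_eq_compact_closure_of[OF Lp_complete[OF p]] by (simp add: Lp_topology_def)
  moreover have "range (\<lambda>n. Lp_class p (f n)) \<subseteq> Lp_class p ` S" using f by auto
  ultimately obtain r where r: "strict_mono r" "MCauchy ((\<lambda>n. Lp_class p (f n)) \<circ> r)"
    unfolding mtotally_bounded_sequentially by blast
  then have "\<exists>N. \<forall>m n. N \<le> m \<longrightarrow> N \<le> n \<longrightarrow> Lp_dist p (Lp_class p (f (r m))) (Lp_class p (f (r n))) < e"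
    using e unfolding MCauchy_def by simp
  then obtain N where "\<And>m n. N \<le> m \<Longrightarrow> N \<le> n \<Longrightarrow> Lp_dist p (Lp_class p (f (r m))) (Lp_class p (f (r n))) < e"
    by blast
  from this[of "Suc N" N] have "Lp_norm p (\<lambda>t. f (r (Suc N)) t - f (r N) t) < e"
    by (simp add: Lp_dist_class[OF p subsetD[OF S f] subsetD[OF S f]])
  moreover have "r N < r (Suc N)" using r by (simp add: strict_mono_Suc_iff)
  ultimately show ?thesis by blast
qed

section \<open>A maximal majorant for fractional integrals\<close>

lemma AE_unit_meas_iff: "(AE t in unit_meas. P t) \<longleftrightarrow> (AE t in lborel. t \<in> {0..1} \<longrightarrow> P t)"
  by (subst AE_restrict_space_iff) (auto simp: AE_completion_iff)

lemma nn_integral_unit_meas: "(\<integral>\<^sup>+t. h t \<partial>unit_meas) = (\<integral>\<^sup>+t. h t * indicator {0..1} t \<partial>lborel)"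
  by (subst nn_integral_restrict_space) (auto simp: nn_integral_completion)

lemma borel_measurable_ident_unit_meas: "(\<lambda>t. t) \<in> borel_measurable unit_meas"
  by (intro measurable_restrict_space1 measurable_completion) simp

text \<open>For measurable \<open>f\<close>, a Borel function on the whole line that vanishes off \<open>[0,1]\<close> and agrees with \<open>f\<close> almost everywhere
  on \<open>[0,1]\<close>.  It makes product measurability and Fubini's theorem available for \<open>lborel\<close>.\<close>

definition borel_rep :: "(real \<Rightarrow> real) \<Rightarrow> real \<Rightarrow> real" where
  "borel_rep f = (SOME F. F \<in> borel_measurable borel \<and> (\<forall>s. s \<notin> {0..1} \<longrightarrow> F s = 0) \<and>
     (AE s in unit_meas. F s = f s))"

lemma borel_rep:
  assumes f: "f \<in> borel_measurable unit_meas"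
  shows borel_rep_measurable: "borel_rep f \<in> borel_measurable borel"
    and borel_rep_outside: "s \<notin> {0..1} \<Longrightarrow> borel_rep f s = 0"
    and borel_rep_AE: "AE s in unit_meas. borel_rep f s = f s"
proof -
  have "(\<lambda>x. if x \<in> {0..1} then f x else 0) \<in> borel_measurable (completion lborel)"
    using f by (subst borel_measurable_if) auto
  from completion_ex_borel_measurable_real[OF this] obtain F where
    F: "F \<in> borel_measurable lborel" "AE x in lborel. (if x \<in> {0..1} then f x else 0) = F x" by auto
  have "\<exists>F. F \<in> borel_measurable borel \<and> (\<forall>s. s \<notin> {0..1} \<longrightarrow> F s = 0) \<and> (AE s in unit_meas. F s = f s)"
  proof (intro exI conjI)
    show "(\<lambda>x. indicator {0..1} x * F x) \<in> borel_measurable borel" using F(1) by simp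
    show "AE s in unit_meas. indicator {0..1} s * F s = f s"
      unfolding AE_unit_meas_iff using F(2) by eventually_elim auto
  qed auto
  from someI_ex[OF this] show "borel_rep f \<in> borel_measurable borel"
    "s \<notin> {0..1} \<Longrightarrow> borel_rep f s = 0" "AE s in unit_meas. borel_rep f s = f s"
    unfolding borel_rep_def[symmetric] by auto
qed

lemma nn_integral_borel_rep:
  assumes f: "f \<in> borel_measurable unit_meas" and G: "G 0 = 0"
  shows "(\<integral>\<^sup>+s. G (borel_rep f s) \<partial>lborel) = (\<integral>\<^sup>+s. G (f s) \<partial>unit_meas)"
proof -
  have "AE s in lborel. G (borel_rep f s) = G (f s) * indicator {0..1} s"
    using borel_rep_AE[OF f, unfolded AE_unit_meas_iff]
  proof eventually_elim
    case (elim s)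
    then show ?case using borel_rep_outside[OF f, of s] G by (cases "s \<in> {0..1}") auto
  qed
  then have "(\<integral>\<^sup>+s. G (borel_rep f s) \<partial>lborel) = (\<integral>\<^sup>+s. G (f s) * indicator {0..1} s \<partial>lborel)"
    by (rule nn_integral_cong_AE)
  then show ?thesis by (simp add: nn_integral_unit_meas)
qed

text \<open>The maximal theorem for \<open>L\<^sub>p[0,1]\<close>, \<open>1 < p \<le> \<infinity>\<close>: the left averages of \<open>f\<close> are dominated by a function
  \<open>g\<close> of comparable norm.  For \<open>p = \<infinity>\<close> the constant function with value \<open>Lp_norm p f\<close> will do.\<close>

lemma left_maximal_Lp:
  assumes p: "1 < p"
  obtains A where "0 < A" and "\<And>f. f \<in> Lp_functions p \<Longrightarrow>
    \<exists>g\<in>Lp_functions p. (\<forall>t. 0 \<le> g t) \<and> Lp_norm p g \<le> A * Lp_norm p f \<and>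
      (AE t in unit_meas. \<forall>h>0. (\<integral>\<^sup>+s\<in>{t-h..t}. ennreal \<bar>borel_rep f s\<bar> \<partial>lborel) \<le> ennreal (h * g t))"
proof (cases "p = \<infinity>")
  case True
  show ?thesis
  proof (rule that[of 1])
    fix f assume f: "f \<in> Lp_functions p"
    have f': "f \<in> borel_measurable unit_meas" using f by (rule Lp_measurable)
    let ?C = "Lp_norm p f"
    have "AE s in unit_meas. \<bar>f s\<bar> \<le> ?C"
      using Lp_norm_le_iff[OF p f' Lp_norm_nonneg, of p f, THEN iffD1, OF conjI[OF f order_refl]] True by simp
    with borel_rep_AE[OF f'] have "AE s in unit_meas. \<bar>borel_rep f s\<bar> \<le> ?C" by eventually_elim simp
    then have b: "AE s in lborel. ennreal \<bar>borel_rep f s\<bar> \<le> ennreal ?C"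
      unfolding AE_unit_meas_iff
    proof eventually_elim
      case (elim s)
      then show ?case
        using borel_rep_outside[OF f', of s] Lp_norm_nonneg[of p f]
        by (cases "s \<in> {0..1}") (auto intro!: ennreal_leI)
    qed
    have "(\<integral>\<^sup>+s\<in>{t-h..t}. ennreal \<bar>borel_rep f s\<bar> \<partial>lborel) \<le> ennreal (h * ?C)" if h: "0 < h" for t h
    proof -
      have "(\<integral>\<^sup>+s\<in>{t-h..t}. ennreal \<bar>borel_rep f s\<bar> \<partial>lborel) \<le> (\<integral>\<^sup>+s. ennreal ?C * indicator {t-h..t} s \<partial>lborel)"
      proof (rule nn_integral_mono_AE)
        show "AE s in lborel. ennreal \<bar>borel_rep f s\<bar> * indicator {t-h..t} s \<le> ennreal ?C * indicator {t-h..t} s"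
          using b by eventually_elim (rule mult_right_mono, auto)
      qed
      also have "\<dots> = ennreal (h * ?C)"
        using h by (subst nn_integral_cmult_indicator) (auto simp: ennreal_mult Lp_norm_nonneg mult.commute)
      finally show ?thesis .
    qed
    then show "\<exists>g\<in>Lp_functions p. (\<forall>t. 0 \<le> g t) \<and> Lp_norm p g \<le> 1 * Lp_norm p f \<and>
      (AE t in unit_meas. \<forall>h>0. (\<integral>\<^sup>+s\<in>{t-h..t}. ennreal \<bar>borel_rep f s\<bar> \<partial>lborel) \<le> ennreal (h * g t))"
      using Lp_norm_le_bound[OF p _ Lp_norm_nonneg[of p f], of "\<lambda>_. ?C"] Lp_norm_nonneg[of p f]
      by (intro bexI[of _ "\<lambda>_. ?C"]) auto
  qed simp
next
  case False
  define q where "q = enn2real p"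
  have q: "1 < q" using p False by (cases p) (auto simp: q_def ennreal_1[symmetric] ennreal_less_iff simp del: ennreal_1)
  define K where "K = 10 * q * 2 powr (q - 1) / (q - 1)"
  have K: "0 < K" using q by (simp add: K_def)
  show ?thesis
  proof (rule that[of "K powr (1 / q)"])
    fix f assume f: "f \<in> Lp_functions p"
    have f': "f \<in> borel_measurable unit_meas" using f by (rule Lp_measurable)
    have [measurable]: "borel_rep f \<in> borel_measurable borel" by (rule borel_rep_measurable[OF f'])
    let ?C = "Lp_norm p f"
    define u where "u s = \<bar>borel_rep f s\<bar>" for s
    have u[measurable]: "u \<in> borel_measurable borel" unfolding u_def by measurable
    have "(\<integral>\<^sup>+s. u s \<partial>lborel) = (\<integral>\<^sup>+s. ennreal \<bar>f s\<bar> \<partial>unit_meas)"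
      unfolding u_def by (rule nn_integral_borel_rep[OF f']) simp
    also have "\<dots> \<le> ennreal (2 * (?C + 1))"
      using Lp_norm_nonneg[of p f] by (intro nn_integral_abs_le_Lp_norm[OF p f]) auto
    also have "\<dots> < \<infinity>" by simp
    finally have fin: "(\<integral>\<^sup>+s. u s \<partial>lborel) < \<infinity>" .
    have "(\<integral>\<^sup>+s. ennreal (u s powr q) \<partial>lborel) = (\<integral>\<^sup>+s. ennreal (\<bar>f s\<bar> powr q) \<partial>unit_meas)"
      unfolding u_def by (rule nn_integral_borel_rep[OF f']) simp
    also have "\<dots> \<le> ennreal (?C powr q)"
      using Lp_norm_le_iff[OF p f' Lp_norm_nonneg, of p f, THEN iffD1, OF conjI[OF f order_refl]] False
      by (simp add: q_def)
    finally have uq: "(\<integral>\<^sup>+s. ennreal (u s powr q) \<partial>lborel) \<le> ennreal (?C powr q)" .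
    define g where "g t = enn2real (left_maximal u t)" for t
    have [measurable]: "g \<in> borel_measurable borel" unfolding g_def by measurable
    have gm: "g \<in> borel_measurable unit_meas" by (intro measurable_restrict_space1 measurable_completion) simp
    have u0: "0 \<le> u s" for s by (simp add: u_def)
    have "(\<integral>\<^sup>+t. ennreal (\<bar>g t\<bar> powr q) \<partial>unit_meas) \<le> (\<integral>\<^sup>+t. ennreal (g t powr q) \<partial>lborel)"
      unfolding nn_integral_unit_meas by (intro nn_integral_mono) (auto simp: g_def split: split_indicator)
    also have "\<dots> \<le> ennreal K * (\<integral>\<^sup>+s. ennreal (u s powr q) \<partial>lborel)"
      unfolding g_def K_def by (rule left_maximal_strong_type(2)[OF u u0 q fin])
    also have "\<dots> \<le> ennreal K * ennreal (?C powr q)" by (rule mult_left_mono[OF uq]) simp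
    also have "\<dots> = ennreal ((K powr (1 / q) * ?C) powr q)"
      using K q by (simp add: ennreal_mult powr_mult powr_powr)
    finally have "g \<in> Lp_functions p \<and> Lp_norm p g \<le> K powr (1 / q) * ?C"
      using False by (subst Lp_norm_le_iff[OF p gm]) (auto simp: Lp_norm_nonneg q_def)
    moreover have "AE t in unit_meas. \<forall>h>0. (\<integral>\<^sup>+s\<in>{t-h..t}. ennreal \<bar>borel_rep f s\<bar> \<partial>lborel) \<le> ennreal (h * g t)"
      unfolding AE_unit_meas_iff using left_maximal_strong_type(1)[OF u u0 q fin]
    proof eventually_elim
      case (elim t)
      then have "left_maximal u t = ennreal (g t)" by (simp add: g_def)
      then show ?case
        using nn_integral_le_left_maximal[where v = "\<lambda>s. ennreal (u s)" and t = t]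
        by (auto simp: u_def ennreal_mult g_def)
    qed
    ultimately show "\<exists>g\<in>Lp_functions p. (\<forall>t. 0 \<le> g t) \<and> Lp_norm p g \<le> K powr (1 / q) * Lp_norm p f \<and>
      (AE t in unit_meas. \<forall>h>0. (\<integral>\<^sup>+s\<in>{t-h..t}. ennreal \<bar>borel_rep f s\<bar> \<partial>lborel) \<le> ennreal (h * g t))"
      by (intro bexI[of _ g]) (auto simp: g_def)
  qed (use K in auto)
qed

text \<open>Integration against the singular kernel reduces to left averages: \<open>{t-d..t}\<close> is cut dyadically, the
  kernel is comparable on each piece to a constant, and the pieces form a geometric series.  The
  bound has the exact power \<open>d powr a\<close>, with a constant depending on \<open>a\<close> only through the factor
  that \<open>rGamma a\<close> compensates.\<close>

lemma singular_integral_le_left_average: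
  fixes u :: "real \<Rightarrow> ennreal"
  assumes u[measurable]: "u \<in> borel_measurable borel" and d: "0 < d" and a: "0 < a" and m: "0 \<le> m"
    and avg: "\<And>h. 0 < h \<Longrightarrow> (\<integral>\<^sup>+s\<in>{t-h..t}. u s \<partial>lborel) \<le> ennreal (h * m)"
  shows "(\<integral>\<^sup>+s\<in>{t-d..t}. ennreal ((t - s) powr (a - 1)) * u s \<partial>lborel)
     \<le> ennreal (2 * d powr a * m / (1 - 2 powr (-a)))"
proof -
  define b where "b k = d / 2 ^ k" for k :: nat
  have b: "0 < b k" for k using d by (simp add: b_def)
  have pw: "ennreal ((t - s) powr (a - 1)) * u s * indicator {t-d..t} s
    \<le> (\<Sum>k. ennreal (2 * b k powr (a - 1)) * (u s * indicator {t - b k..t} s))" for s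
  proof (cases "s \<in> {t-d..<t}")
    case True
    define j where "j = (LEAST k. b k < t - s)"
    have "(\<lambda>k. d * (1/2) ^ k) \<longlonglongrightarrow> d * 0" by (intro tendsto_mult tendsto_const LIMSEQ_realpow_zero) auto
    then have "\<forall>\<^sub>F k in sequentially. d * (1/2) ^ k < t - s"
      using True by (intro order_tendstoD(2)[of _ "d * 0"]) auto
    then obtain k where "d * (1/2) ^ k < t - s" by (auto simp: eventually_sequentially)
    then have ex: "\<exists>k. b k < t - s" by (auto simp: b_def power_divide)
    then have j: "b j < t - s" unfolding j_def by (rule LeastI_ex)
    have "j \<noteq> 0" using j True by (intro notI) (simp add: b_def)
    then obtain k where k: "j = Suc k" by (cases j) auto
    have bk: "t - s \<le> b k" using not_less_Least[of k "\<lambda>k. b k < t - s"] k by (auto simp: j_def)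
    have jk: "b k / 2 < t - s" using j by (simp add: k b_def)
    \<comment> \<open>Splitting the power in this way gives the same constant for \<open>a < 1\<close> and for \<open>a \<ge> 1\<close>.\<close>
    have "(t - s) powr (a - 1) = (t - s) powr a / (t - s)" using True by (simp add: powr_diff)
    also have "\<dots> \<le> b k powr a / (b k / 2)"
      using bk jk b[of k] a by (intro frac_le powr_mono2) auto
    also have "\<dots> = 2 * b k powr (a - 1)" using b[of k] by (simp add: powr_diff)
    finally have "ennreal ((t - s) powr (a - 1)) * u s * indicator {t-d..t} s
        \<le> ennreal (2 * b k powr (a - 1)) * (u s * indicator {t - b k..t} s)"
      using True bk by (auto intro!: mult_right_mono ennreal_leI)
    also have "\<dots> = (\<Sum>k\<in>{k}. ennreal (2 * b k powr (a - 1)) * (u s * indicator {t - b k..t} s))" by simp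
    also have "\<dots> \<le> (\<Sum>k. ennreal (2 * b k powr (a - 1)) * (u s * indicator {t - b k..t} s))"
      by (rule sum_le_suminf) auto
    finally show ?thesis .
  next
    case False
    \<comment> \<open>At \<open>s = t\<close> the kernel is 0, by the convention \<open>0 powr x = 0\<close>.\<close>
    then have "ennreal ((t - s) powr (a - 1)) * u s * indicator {t-d..t} s = 0"
      by (cases "s = t") auto
    then show ?thesis by (simp only: zero_le)
  qed
  have r: "0 < 2 powr (-a)" "2 powr (-a) < 1" using a by (auto simp: powr_less_one)
  have "(\<integral>\<^sup>+s\<in>{t-d..t}. ennreal ((t - s) powr (a - 1)) * u s \<partial>lborel)
    \<le> (\<integral>\<^sup>+s. (\<Sum>k. ennreal (2 * b k powr (a - 1)) * (u s * indicator {t - b k..t} s)) \<partial>lborel)"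
    by (intro nn_integral_mono pw)
  also have "\<dots> = (\<Sum>k. ennreal (2 * b k powr (a - 1)) * (\<integral>\<^sup>+s\<in>{t - b k..t}. u s \<partial>lborel))"
    by (subst nn_integral_suminf) (auto simp: nn_integral_cmult)
  also have "\<dots> \<le> (\<Sum>k. ennreal (2 * d powr a * m * (2 powr (-a)) ^ k))"
  proof (rule suminf_le)
    fix k
    have "ennreal (2 * b k powr (a - 1)) * (\<integral>\<^sup>+s\<in>{t - b k..t}. u s \<partial>lborel)
      \<le> ennreal (2 * b k powr (a - 1)) * ennreal (b k * m)"
      by (intro mult_left_mono avg b) simp
    also have "\<dots> = ennreal (2 * (b k powr (a - 1) * b k) * m)"
      using b[of k] m by (simp add: ennreal_mult[symmetric] mult_ac)
    also have "b k powr (a - 1) * b k = b k powr a" using b[of k] by (simp add: powr_diff)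
    also have "b k powr a = d powr a * (2 powr (-a)) ^ k"
    proof -
      have "(2 ^ k) powr a = (2 powr a) ^ k" by (simp add: powr_realpow[symmetric] powr_powr mult.commute)
      moreover have "b k powr a = d powr a / (2 ^ k) powr a" by (simp only: b_def powr_divide)
      ultimately show ?thesis by (simp add: powr_minus power_inverse divide_inverse)
    qed
    finally show "ennreal (2 * b k powr (a - 1)) * (\<integral>\<^sup>+s\<in>{t - b k..t}. u s \<partial>lborel)
      \<le> ennreal (2 * d powr a * m * (2 powr (-a)) ^ k)" by (simp add: mult_ac)
  qed auto
  also have "\<dots> = ennreal (\<Sum>k. 2 * d powr a * m * (2 powr (-a)) ^ k)"
    using r m by (intro suminf_ennreal2 summable_mult summable_geometric) auto
  also have "(\<Sum>k. 2 * d powr a * m * (2 powr (-a)) ^ k) = 2 * d powr a * m / (1 - 2 powr (-a))"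
    using r by (subst suminf_mult) (auto simp: suminf_geometric summable_geometric)
  finally show ?thesis .
qed

text \<open>The number \<open>m\<close> controls all fractional integrals of \<open>f\<close> at the point \<open>t\<close>, of any order \<open>a\<close> and
  truncated to any interval \<open>{t-d..t}\<close>, at the scale \<open>d powr a\<close>.\<close>

definition RL_majorized :: "(real \<Rightarrow> real) \<Rightarrow> real \<Rightarrow> real \<Rightarrow> bool" where
  "RL_majorized f m t \<longleftrightarrow> (\<forall>a>0. \<forall>d>0.
     ennreal (rGamma a) * (\<integral>\<^sup>+s\<in>{t-d..t}. ennreal ((t - s) powr (a - 1)) * ennreal \<bar>borel_rep f s\<bar> \<partial>lborel)
       \<le> ennreal (d powr a * m))"

text \<open>The main estimate.  The majorant \<open>g\<close> does not depend on the order, so the order may afterwards be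
  chosen as an arbitrary function of \<open>t\<close>.\<close>

lemma riemann_liouville_majorant:
  assumes p: "1 < p"
  obtains A where "0 < A" and "\<And>f. f \<in> Lp_functions p \<Longrightarrow>
    \<exists>g\<in>Lp_functions p. (\<forall>t. 0 \<le> g t) \<and> Lp_norm p g \<le> A * Lp_norm p f \<and>
      (AE t in unit_meas. RL_majorized f (g t) t)"
proof -
  obtain A where A: "0 < A" and *: "\<And>f. f \<in> Lp_functions p \<Longrightarrow>
    \<exists>g\<in>Lp_functions p. (\<forall>t. 0 \<le> g t) \<and> Lp_norm p g \<le> A * Lp_norm p f \<and>
      (AE t in unit_meas. \<forall>h>0. (\<integral>\<^sup>+s\<in>{t-h..t}. ennreal \<bar>borel_rep f s\<bar> \<partial>lborel) \<le> ennreal (h * g t))"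
    by (rule left_maximal_Lp[OF p]) blast
  obtain D :: real where D: "0 < D" "\<And>a. 0 < a \<Longrightarrow> rGamma a / (1 - 2 powr (-a)) \<le> D"
    by (rule rGamma_geometric_bound) blast
  show ?thesis
  proof (rule that[of "2 * D * A"])
    fix f assume f: "f \<in> Lp_functions p"
    have [measurable]: "borel_rep f \<in> borel_measurable borel" by (rule borel_rep_measurable[OF Lp_measurable[OF f]])
    obtain g where g: "g \<in> Lp_functions p" "\<And>t. 0 \<le> g t" "Lp_norm p g \<le> A * Lp_norm p f"
      and avg: "AE t in unit_meas. \<forall>h>0. (\<integral>\<^sup>+s\<in>{t-h..t}. ennreal \<bar>borel_rep f s\<bar> \<partial>lborel) \<le> ennreal (h * g t)"
      using *[OF f] by blast
    have "AE t in unit_meas. RL_majorized f (2 * D * g t) t"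
      using avg
    proof eventually_elim
      case (elim t)
      show ?case
        unfolding RL_majorized_def
      proof (intro allI impI)
        fix a d :: real assume a: "0 < a" and d: "0 < d"
        have "ennreal (rGamma a) * (\<integral>\<^sup>+s\<in>{t-d..t}. ennreal ((t - s) powr (a - 1)) * ennreal \<bar>borel_rep f s\<bar> \<partial>lborel)
          \<le> ennreal (rGamma a) * ennreal (2 * d powr a * g t / (1 - 2 powr (-a)))"
          using elim by (intro mult_left_mono singular_integral_le_left_average[OF _ d a g(2)]) auto
        also have "\<dots> = ennreal (2 * d powr a * g t * (rGamma a / (1 - 2 powr (-a))))"
          using a g(2)[of t] by (subst ennreal_mult[symmetric])
            (auto intro!: rGamma_real_nonneg divide_nonneg_nonneg simp: powr_less_one less_imp_le mult_ac)
        also have "\<dots> \<le> ennreal (2 * d powr a * g t * D)"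
          using D(2)[OF a] g(2)[of t] by (intro ennreal_leI mult_left_mono) auto
        finally show "ennreal (rGamma a) * (\<integral>\<^sup>+s\<in>{t-d..t}. ennreal ((t - s) powr (a - 1)) * ennreal \<bar>borel_rep f s\<bar> \<partial>lborel)
          \<le> ennreal (d powr a * (2 * D * g t))" by (simp add: mult_ac)
      qed
    qed
    moreover have "Lp_norm p (\<lambda>t. 2 * D * g t) \<le> 2 * D * A * Lp_norm p f"
    proof -
      have "Lp_norm p (\<lambda>t. 2 * D * g t) \<le> \<bar>2 * D\<bar> * Lp_norm p g" by (rule Lp_scale(2)[OF p g(1)])
      also have "\<dots> \<le> 2 * D * (A * Lp_norm p f)" using D g(3) by (auto intro!: mult_mono)
      finally show ?thesis by (simp add: mult_ac)
    qed
    ultimately show "\<exists>g\<in>Lp_functions p. (\<forall>t. 0 \<le> g t) \<and> Lp_norm p g \<le> 2 * D * A * Lp_norm p f \<and>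
      (AE t in unit_meas. RL_majorized f (g t) t)"
      using D g(2) Lp_scale(1)[OF p g(1), of "2 * D"] by (intro bexI[of _ "\<lambda>t. 2 * D * g t"]) auto
  qed (use A D in auto)
qed

section \<open>Boundedness\<close>

text \<open>Any function dominated by the singular integrand near \<open>t\<close> inherits its bound.  This is used for the
  operator itself, with \<open>d = t\<close>, and for the error made by truncating the kernel.\<close>

lemma RL_majorized_integral_bound:
  assumes f: "f \<in> borel_measurable unit_meas" and maj: "RL_majorized f m t"
    and a: "0 < a" and d: "0 < d" and m: "0 \<le> m"
    and w[measurable]: "w \<in> borel_measurable borel"
    and le: "\<And>s. \<bar>w s\<bar> \<le> indicator {t-d..t} s * ((t - s) powr (a - 1) * \<bar>borel_rep f s\<bar>)"
  shows "integrable lborel w" "\<bar>rGamma a * (LINT s|lborel. w s)\<bar> \<le> d powr a * m"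
proof -
  have [measurable]: "borel_rep f \<in> borel_measurable borel" by (rule borel_rep_measurable[OF f])
  have G: "0 < rGamma a" using Gamma_real_pos[OF a] by (simp add: rGamma_inverse_Gamma)
  have "(\<integral>\<^sup>+s. ennreal \<bar>w s\<bar> \<partial>lborel)
      \<le> (\<integral>\<^sup>+s\<in>{t-d..t}. ennreal ((t - s) powr (a - 1)) * ennreal \<bar>borel_rep f s\<bar> \<partial>lborel)"
  proof (rule nn_integral_mono)
    fix s
    have "ennreal \<bar>w s\<bar> \<le> ennreal (indicator {t-d..t} s * ((t - s) powr (a - 1) * \<bar>borel_rep f s\<bar>))"
      by (rule ennreal_leI[OF le])
    also have "\<dots> = ennreal ((t - s) powr (a - 1)) * ennreal \<bar>borel_rep f s\<bar> * indicator {t-d..t} s"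
      by (auto simp: ennreal_mult split: split_indicator)
    finally show "ennreal \<bar>w s\<bar> \<le> ennreal ((t - s) powr (a - 1)) * ennreal \<bar>borel_rep f s\<bar> * indicator {t-d..t} s" .
  qed
  then have "ennreal (rGamma a) * (\<integral>\<^sup>+s. ennreal \<bar>w s\<bar> \<partial>lborel) \<le> ennreal (rGamma a) *
      (\<integral>\<^sup>+s\<in>{t-d..t}. ennreal ((t - s) powr (a - 1)) * ennreal \<bar>borel_rep f s\<bar> \<partial>lborel)"
    by (rule mult_left_mono) simp
  also have "\<dots> \<le> ennreal (d powr a * m)" using maj a d by (simp add: RL_majorized_def)
  finally have bd: "ennreal (rGamma a) * (\<integral>\<^sup>+s. ennreal \<bar>w s\<bar> \<partial>lborel) \<le> ennreal (d powr a * m)" .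
  have "(\<integral>\<^sup>+s. ennreal \<bar>w s\<bar> \<partial>lborel) < \<infinity>"
  proof (rule ccontr)
    assume "\<not> ?thesis"
    then have "(\<integral>\<^sup>+s. ennreal \<bar>w s\<bar> \<partial>lborel) = \<infinity>" by (simp add: less_top[symmetric])
    with bd G show False by (simp add: ennreal_mult_top top_unique)
  qed
  then show int: "integrable lborel w" by (intro integrableI_bounded) auto
  have "ennreal (rGamma a * (LINT s|lborel. \<bar>w s\<bar>)) = ennreal (rGamma a) * (\<integral>\<^sup>+s. ennreal \<bar>w s\<bar> \<partial>lborel)"
    using int G by (subst nn_integral_eq_integral) (auto simp: ennreal_mult)
  with bd have "ennreal (rGamma a * (LINT s|lborel. \<bar>w s\<bar>)) \<le> ennreal (d powr a * m)" by (simp only:)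
  then have "rGamma a * (LINT s|lborel. \<bar>w s\<bar>) \<le> d powr a * m"
    using ennreal_le_iff[of "d powr a * m"] m by simp
  moreover have "\<bar>rGamma a * (LINT s|lborel. w s)\<bar> \<le> rGamma a * (LINT s|lborel. \<bar>w s\<bar>)"
    using G integral_norm_bound[of lborel w] by (auto simp: abs_mult)
  ultimately show "\<bar>rGamma a * (LINT s|lborel. w s)\<bar> \<le> d powr a * m" by linarith
qed

text \<open>The integrand defining the Riemann--Liouville integral of order \<open>a\<close> at \<open>t\<close>, for the Borel
  representative and without the factor \<open>rGamma a\<close>.\<close>

definition RL_integrand :: "real \<Rightarrow> real \<Rightarrow> (real \<Rightarrow> real) \<Rightarrow> real \<Rightarrow> real" where
  "RL_integrand a t f s = indicator {0..t} s * ((t - s) powr (a - 1) * borel_rep f s)"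

lemma RL_integrand_measurable:
  assumes "f \<in> borel_measurable unit_meas"
  shows "RL_integrand a t f \<in> borel_measurable borel"
proof -
  have [measurable]: "borel_rep f \<in> borel_measurable borel" by (rule borel_rep_measurable[OF assms])
  show ?thesis unfolding RL_integrand_def by measurable
qed

lemma riemann_liouville_eq:
  assumes f: "f \<in> borel_measurable unit_meas" and t: "t \<in> {0..1}"
  shows "riemann_liouville \<alpha> f t = rGamma (\<alpha> t) * (LINT s|lborel. RL_integrand (\<alpha> t) t f s)"
proof -
  have [measurable]: "borel_rep f \<in> borel_measurable borel" by (rule borel_rep_measurable[OF f])
  have m[measurable]: "(\<lambda>x. if x \<in> {0..1} then f x else 0) \<in> borel_measurable (completion lborel)"
    using f by (subst borel_measurable_if) auto
  have b: "h \<in> borel_measurable (completion lborel)" if "h \<in> borel_measurable borel" for h :: "real \<Rightarrow> real"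
    using that by (intro measurable_completion) simp
  have "(LINT s:{0..t}|lebesgue. (t - s) powr (\<alpha> t - 1) * f s)
     = (LINT s|completion lborel. (indicator {0..t} s * (t - s) powr (\<alpha> t - 1)) * (if s \<in> {0..1} then f s else 0))"
    unfolding set_lebesgue_integral_def using t
    by (intro Bochner_Integration.integral_cong) (auto split: split_indicator)
  also have "\<dots> = (LINT s|completion lborel. RL_integrand (\<alpha> t) t f s)"
  proof (rule integral_cong_AE)
    show "(\<lambda>s. (indicator {0..t} s * (t - s) powr (\<alpha> t - 1)) * (if s \<in> {0..1} then f s else 0))
        \<in> borel_measurable (completion lborel)"
      by (intro borel_measurable_times[OF b m]) measurable
    show "RL_integrand (\<alpha> t) t f \<in> borel_measurable (completion lborel)"
      by (intro b RL_integrand_measurable f)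
    show "AE s in completion lborel. indicator {0..t} s * (t - s) powr (\<alpha> t - 1) * (if s \<in> {0..1} then f s else 0)
        = RL_integrand (\<alpha> t) t f s"
      unfolding AE_completion_iff using borel_rep_AE[OF f, unfolded AE_unit_meas_iff]
      by eventually_elim (use t in \<open>auto simp: RL_integrand_def split: split_indicator\<close>)
  qed
  also have "\<dots> = (LINT s|lborel. RL_integrand (\<alpha> t) t f s)"
    using RL_integrand_measurable[OF f] by (intro integral_completion) simp
  finally show ?thesis by (simp add: riemann_liouville_def rGamma_inverse_Gamma divide_inverse)
qed

lemma riemann_liouville_measurable:
  assumes \<alpha>[measurable]: "\<alpha> \<in> borel_measurable unit_meas" and f: "f \<in> borel_measurable unit_meas"
  shows "riemann_liouville \<alpha> f \<in> borel_measurable unit_meas"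
proof -
  have [measurable]: "borel_rep f \<in> borel_measurable borel" by (rule borel_rep_measurable[OF f])
  note [measurable] = borel_measurable_ident_unit_meas
  have [measurable]: "(rGamma :: real \<Rightarrow> real) \<in> borel_measurable borel"
    by (intro borel_measurable_continuous_onI continuous_on_rGamma)
  have "(\<lambda>x. indicator {y::real\<times>real. 0 \<le> snd y \<and> snd y \<le> fst y} (fst x, snd x) *
       ((fst x - snd x) powr (\<alpha> (fst x) - 1) * borel_rep f (snd x))) \<in> borel_measurable (unit_meas \<Otimes>\<^sub>M lborel)"
    by measurable
  then have "(\<lambda>t. LINT s|lborel. indicator {y::real\<times>real. 0 \<le> snd y \<and> snd y \<le> fst y} (t, s) *
       ((t - s) powr (\<alpha> t - 1) * borel_rep f s)) \<in> borel_measurable unit_meas"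
    by (intro lborel.borel_measurable_lebesgue_integral) (simp add: case_prod_beta')
  then have [measurable]: "(\<lambda>t. LINT s|lborel. RL_integrand (\<alpha> t) t f s) \<in> borel_measurable unit_meas"
    by (simp add: RL_integrand_def indicator_def)
  have "(\<lambda>t. rGamma (\<alpha> t) * (LINT s|lborel. RL_integrand (\<alpha> t) t f s)) \<in> borel_measurable unit_meas"
    by measurable
  then show ?thesis
    by (rule measurable_cong[THEN iffD1, rotated]) (simp add: riemann_liouville_eq[OF f])
qed

lemma RL_majorized_riemann_liouville:
  assumes f: "f \<in> borel_measurable unit_meas" and maj: "RL_majorized f m t"
    and a: "0 < \<alpha> t" and t: "0 < t" "t \<le> 1" and m: "0 \<le> m"
  shows "integrable lborel (RL_integrand (\<alpha> t) t f)"
    and "\<bar>riemann_liouville \<alpha> f t\<bar> \<le> t powr \<alpha> t * m"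
proof -
  have le: "\<bar>RL_integrand (\<alpha> t) t f s\<bar> \<le> indicator {t-t..t} s * ((t - s) powr (\<alpha> t - 1) * \<bar>borel_rep f s\<bar>)" for s
    by (auto simp: RL_integrand_def abs_mult split: split_indicator)
  note * = RL_majorized_integral_bound[OF f maj a t(1) m RL_integrand_measurable[OF f] le]
  show "integrable lborel (RL_integrand (\<alpha> t) t f)" by (rule *(1))
  show "\<bar>riemann_liouville \<alpha> f t\<bar> \<le> t powr \<alpha> t * m"
    using *(2) t by (simp add: riemann_liouville_eq[OF f])
qed

lemma AE_unit_meas_pos: "AE t in unit_meas. 0 < t \<and> t \<le> 1"
  unfolding AE_unit_meas_iff using AE_lborel_singleton[of 0] by eventually_elim auto

text \<open>Since \<open>t powr \<alpha> t \<le> 1\<close> on \<open>(0,1]\<close>, the maximal majorant bounds the operator by itself.\<close>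

theorem riemann_liouville_bounded:
  assumes p: "1 < p" and \<alpha>: "\<alpha> \<in> borel_measurable unit_meas"
    and pos: "\<And>t. t \<in> {0<..1} \<Longrightarrow> \<alpha> t > 0"
  shows "bounded_operator_in_Lp p (riemann_liouville \<alpha>)"
proof -
  obtain A where A: "0 < A" and maj: "\<And>f. f \<in> Lp_functions p \<Longrightarrow>
    \<exists>g\<in>Lp_functions p. (\<forall>t. 0 \<le> g t) \<and> Lp_norm p g \<le> A * Lp_norm p f \<and>
      (AE t in unit_meas. RL_majorized f (g t) t)"
    by (rule riemann_liouville_majorant[OF p]) blast
  have bd: "riemann_liouville \<alpha> f \<in> Lp_functions p \<and> Lp_norm p (riemann_liouville \<alpha> f) \<le> A * Lp_norm p f
      \<and> (AE t in unit_meas. integrable lborel (RL_integrand (\<alpha> t) t f))"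
    if f: "f \<in> Lp_functions p" for f
  proof -
    have f': "f \<in> borel_measurable unit_meas" using f by (rule Lp_measurable)
    obtain g where g: "g \<in> Lp_functions p" "\<And>t. 0 \<le> g t" "Lp_norm p g \<le> A * Lp_norm p f"
      and AE: "AE t in unit_meas. RL_majorized f (g t) t" using maj[OF f] by blast
    have "AE t in unit_meas. \<bar>riemann_liouville \<alpha> f t\<bar> \<le> \<bar>g t\<bar> \<and> integrable lborel (RL_integrand (\<alpha> t) t f)"
      using AE AE_unit_meas_pos
    proof eventually_elim
      case (elim t)
      have \<alpha>t: "0 < \<alpha> t" using pos elim by simp
      have "\<bar>riemann_liouville \<alpha> f t\<bar> \<le> t powr \<alpha> t * g t"
        using elim \<alpha>t g(2) by (intro RL_majorized_riemann_liouville(2)[OF f']) auto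
      also have "\<dots> \<le> 1 * g t"
        using elim \<alpha>t g(2)[of t] by (intro mult_right_mono powr_le1) auto
      finally show ?case
        using elim \<alpha>t g(2)[of t] RL_majorized_riemann_liouville(1)[where \<alpha> = \<alpha>, OF f' elim(1) \<alpha>t] by simp
    qed
    then have b: "AE t in unit_meas. \<bar>riemann_liouville \<alpha> f t\<bar> \<le> \<bar>g t\<bar>"
      and i: "AE t in unit_meas. integrable lborel (RL_integrand (\<alpha> t) t f)" by simp_all
    show ?thesis
      using Lp_dominated[OF p riemann_liouville_measurable[OF \<alpha> f'] g(1) b] g(3) i by auto
  qed
  have lin: "AE t in unit_meas. riemann_liouville \<alpha> (\<lambda>s. a * f s + b * g s) t
      = a * riemann_liouville \<alpha> f t + b * riemann_liouville \<alpha> g t"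
    if f: "f \<in> Lp_functions p" and g: "g \<in> Lp_functions p" for f g a b
  proof -
    have f': "f \<in> borel_measurable unit_meas" and g': "g \<in> borel_measurable unit_meas"
      using f g by (auto intro: Lp_measurable)
    let ?h = "\<lambda>s. a * f s + b * g s"
    have h': "?h \<in> borel_measurable unit_meas" using f' g' by measurable
    have eq: "AE s in lborel. borel_rep ?h s = a * borel_rep f s + b * borel_rep g s"
      using borel_rep_AE[OF f', unfolded AE_unit_meas_iff] borel_rep_AE[OF g', unfolded AE_unit_meas_iff]
        borel_rep_AE[OF h', unfolded AE_unit_meas_iff]
    proof eventually_elim
      case (elim s)
      then show ?case
        using borel_rep_outside[OF f', of s] borel_rep_outside[OF g', of s] borel_rep_outside[OF h', of s]
        by (cases "s \<in> {0..1}") auto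
    qed
    have if': "AE t in unit_meas. integrable lborel (RL_integrand (\<alpha> t) t f)"
      and ig: "AE t in unit_meas. integrable lborel (RL_integrand (\<alpha> t) t g)" using bd f g by auto
    show ?thesis
      using if' ig AE_unit_meas_pos
    proof eventually_elim
      case (elim t)
      have t: "t \<in> {0..1}" using elim by simp
      have "(LINT s|lborel. RL_integrand (\<alpha> t) t ?h s)
         = (LINT s|lborel. a * RL_integrand (\<alpha> t) t f s + b * RL_integrand (\<alpha> t) t g s)"
      proof (rule integral_cong_AE)
        show "AE s in lborel. RL_integrand (\<alpha> t) t ?h s = a * RL_integrand (\<alpha> t) t f s + b * RL_integrand (\<alpha> t) t g s"
          using eq by eventually_elim (simp add: RL_integrand_def algebra_simps)
      qed (use elim(1,2) RL_integrand_measurable[OF h'] in auto)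
      also have "\<dots> = a * (LINT s|lborel. RL_integrand (\<alpha> t) t f s) + b * (LINT s|lborel. RL_integrand (\<alpha> t) t g s)"
        using elim by simp
      finally show ?case
        by (simp add: riemann_liouville_eq[OF f' t] riemann_liouville_eq[OF g' t] riemann_liouville_eq[OF h' t] algebra_simps)
    qed
  qed
  show ?thesis
    unfolding bounded_operator_in_Lp_def using bd lin by blast
qed

section \<open>Compactness\<close>

text \<open>A truncation of the kernel \<open>u powr (a - 1)\<close>, \<open>u > 0\<close>: it equals the kernel for \<open>u \<ge> d\<close>, vanishes for
  \<open>u \<le> 0\<close>, lies between 0 and the kernel in between, and is jointly continuous in \<open>u\<close> and \<open>a > 0\<close>.\<close>

definition smooth_kernel :: "real \<Rightarrow> real \<Rightarrow> real \<Rightarrow> real" where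
  "smooth_kernel d u a = (max u 0) powr a / max u d"

text \<open>The fractional integral with the truncated kernel, as a function of the point \<open>t\<close> and the order \<open>a\<close>
  taken as independent variables.\<close>

definition smooth_RL :: "real \<Rightarrow> (real \<Rightarrow> real) \<Rightarrow> real \<Rightarrow> real \<Rightarrow> real" where
  "smooth_RL d f t a = (LINT s|lborel. rGamma a * smooth_kernel d (t - s) a * borel_rep f s)"

lemma smooth_kernel_bounds:
  assumes d: "0 < d" and a: "0 < a"
  shows "0 \<le> smooth_kernel d u a" "u \<le> 0 \<Longrightarrow> smooth_kernel d u a = 0"
    "smooth_kernel d u a \<le> u powr (a - 1) \<or> u \<le> 0"
    "d \<le> u \<Longrightarrow> smooth_kernel d u a = u powr (a - 1)"
    "u \<le> 1 \<Longrightarrow> smooth_kernel d u a \<le> 1 / d"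
proof -
  show "0 \<le> smooth_kernel d u a" using d by (simp add: smooth_kernel_def)
  show "u \<le> 0 \<Longrightarrow> smooth_kernel d u a = 0" using a by (simp add: smooth_kernel_def max_absorb2)
  show "smooth_kernel d u a \<le> u powr (a - 1) \<or> u \<le> 0"
  proof (cases "u \<le> 0")
    case False
    then have "smooth_kernel d u a \<le> u powr a / u"
      unfolding smooth_kernel_def using d by (simp add: max_absorb1 divide_left_mono)
    also have "\<dots> = u powr (a - 1)" using False by (simp add: powr_diff)
    finally show ?thesis by simp
  qed simp
  show "d \<le> u \<Longrightarrow> smooth_kernel d u a = u powr (a - 1)"
    using d by (simp add: smooth_kernel_def powr_diff max_absorb1)
  show "smooth_kernel d u a \<le> 1 / d" if "u \<le> 1"
    unfolding smooth_kernel_def using that d a by (intro frac_le powr_le1) auto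
qed

lemma smooth_kernel_continuous:
  assumes "0 < d"
  shows "continuous_on (UNIV \<times> {0<..}) (\<lambda>x. rGamma (snd x) * smooth_kernel d (fst x) (snd x))"
  unfolding smooth_kernel_def using assms
  by (intro continuous_intros continuous_on_powr' continuous_on_compose2[OF continuous_on_rGamma]) auto

lemma smooth_kernel_measurable [measurable]: "(\<lambda>s. smooth_kernel d (t - s) a) \<in> borel_measurable borel"
  unfolding smooth_kernel_def by measurable

context
  fixes p :: ennreal and f :: "real \<Rightarrow> real"
  assumes p: "1 < p" and f: "f \<in> Lp_functions p" and f1: "Lp_norm p f \<le> 1"
begin

private lemma f_meas: "f \<in> borel_measurable unit_meas"
  using f by (rule Lp_measurable)

private lemma rep_meas [measurable]: "borel_rep f \<in> borel_measurable borel"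
  by (rule borel_rep_measurable[OF f_meas])

lemma borel_rep_L1:
  shows "integrable lborel (borel_rep f)" "(LINT s|lborel. \<bar>borel_rep f s\<bar>) \<le> 2"
proof -
  have *: "(\<integral>\<^sup>+s. ennreal \<bar>borel_rep f s\<bar> \<partial>lborel) \<le> ennreal 2"
    using nn_integral_abs_le_Lp_norm[OF p f f1] nn_integral_borel_rep[OF f_meas, of "\<lambda>x. ennreal \<bar>x\<bar>"] by simp
  then show i: "integrable lborel (borel_rep f)"
    by (intro integrableI_bounded) (auto intro: le_less_trans)
  then have "ennreal (LINT s|lborel. \<bar>borel_rep f s\<bar>) \<le> ennreal 2"
    using * by (subst nn_integral_eq_integral[symmetric]) auto
  then show "(LINT s|lborel. \<bar>borel_rep f s\<bar>) \<le> 2" by (subst (asm) ennreal_le_iff) auto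
qed

lemma bounded_kernel_integral:
  assumes w: "w \<in> borel_measurable borel" and C: "0 \<le> C" and le: "\<And>s. s \<in> {0..1} \<Longrightarrow> \<bar>w s\<bar> \<le> C"
  shows "integrable lborel (\<lambda>s. w s * borel_rep f s)"
    and "\<bar>LINT s|lborel. w s * borel_rep f s\<bar> \<le> 2 * C"
proof -
  have b: "\<bar>w s * borel_rep f s\<bar> \<le> C * \<bar>borel_rep f s\<bar>" for s
  proof (cases "s \<in> {0..1}")
    case True
    show ?thesis unfolding abs_mult by (rule mult_right_mono[OF le[OF True]]) simp
  next
    case False
    then show ?thesis by (simp add: borel_rep_outside[OF f_meas])
  qed
  have [measurable]: "w \<in> borel_measurable borel" by (rule w)
  show i: "integrable lborel (\<lambda>s. w s * borel_rep f s)"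
  proof (rule Bochner_Integration.integrable_bound)
    show "integrable lborel (\<lambda>s. C * \<bar>borel_rep f s\<bar>)" using borel_rep_L1(1) by simp
    have "norm (w s * borel_rep f s) \<le> norm (C * \<bar>borel_rep f s\<bar>)" for s
      unfolding real_norm_def by (rule order_trans[OF b abs_ge_self])
    then show "AE s in lborel. norm (w s * borel_rep f s) \<le> norm (C * \<bar>borel_rep f s\<bar>)" by simp
  qed measurable
  have "\<bar>LINT s|lborel. w s * borel_rep f s\<bar> \<le> (LINT s|lborel. \<bar>w s * borel_rep f s\<bar>)"
    using integral_norm_bound[of lborel "\<lambda>s. w s * borel_rep f s"] by simp
  also have "\<dots> \<le> (LINT s|lborel. C * \<bar>borel_rep f s\<bar>)"
    using i borel_rep_L1(1) by (intro integral_mono b) auto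
  also have "\<dots> = C * (LINT s|lborel. \<bar>borel_rep f s\<bar>)" by simp
  also have "\<dots> \<le> C * 2" by (rule mult_left_mono[OF borel_rep_L1(2) C])
  also have "\<dots> = 2 * C" by simp
  finally show "\<bar>LINT s|lborel. w s * borel_rep f s\<bar> \<le> 2 * C" .
qed

lemma smooth_RL_bound:
  assumes d: "0 < d" and a: "0 < a" and t: "t \<le> 1"
  shows "integrable lborel (\<lambda>s. rGamma a * smooth_kernel d (t - s) a * borel_rep f s)"
    and "\<bar>smooth_RL d f t a\<bar> \<le> 2 * (rGamma a / d)"
proof -
  have le: "\<bar>rGamma a * smooth_kernel d (t - s) a\<bar> \<le> rGamma a / d" if "s \<in> {0..1}" for s
    using smooth_kernel_bounds(1,5)[OF d a, of "t - s"] t that rGamma_real_nonneg[of a] a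
      mult_left_mono[of "smooth_kernel d (t - s) a" "1 / d" "rGamma a"]
    by (simp add: abs_mult)
  have "0 \<le> rGamma a / d" using rGamma_real_nonneg[of a] a d by simp
  from bounded_kernel_integral[OF _ this le]
  show "integrable lborel (\<lambda>s. rGamma a * smooth_kernel d (t - s) a * borel_rep f s)"
    "\<bar>smooth_RL d f t a\<bar> \<le> 2 * (rGamma a / d)"
    unfolding smooth_RL_def by simp_all
qed

lemma smooth_RL_diff:
  assumes d: "0 < d" and a: "0 < a" "0 < b" and t: "t \<le> 1" "r \<le> 1" and e: "0 \<le> e"
    and le: "\<And>s. s \<in> {0..1} \<Longrightarrow>
       \<bar>rGamma a * smooth_kernel d (t - s) a - rGamma b * smooth_kernel d (r - s) b\<bar> \<le> e"
  shows "\<bar>smooth_RL d f t a - smooth_RL d f r b\<bar> \<le> 2 * e"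
proof -
  have "smooth_RL d f t a - smooth_RL d f r b =
    (LINT s|lborel. (rGamma a * smooth_kernel d (t - s) a - rGamma b * smooth_kernel d (r - s) b) * borel_rep f s)"
    unfolding smooth_RL_def
    using smooth_RL_bound(1)[OF d a(1) t(1)] smooth_RL_bound(1)[OF d a(2) t(2)]
    by (simp only: Bochner_Integration.integral_diff[symmetric] left_diff_distrib)
  then show ?thesis
    using bounded_kernel_integral(2)[OF _ e le] by simp
qed

text \<open>The truncation changes the kernel only at distance less than \<open>d\<close> from the singularity, so the error
  is of size \<open>d powr \<alpha> t\<close>.\<close>

lemma riemann_liouville_smooth_diff:
  assumes maj: "RL_majorized f m t" and a: "0 < \<alpha> t" and d: "0 < d" and t: "0 < t" "t \<le> 1" and m: "0 \<le> m"
  shows "\<bar>riemann_liouville \<alpha> f t - smooth_RL d f t (\<alpha> t)\<bar> \<le> d powr \<alpha> t * m"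
proof -
  let ?a = "\<alpha> t"
  let ?w = "\<lambda>s. RL_integrand ?a t f s - smooth_kernel d (t - s) ?a * borel_rep f s"
  note [measurable] = RL_integrand_measurable[OF f_meas]
  have le: "\<bar>?w s\<bar> \<le> indicator {t-d..t} s * ((t - s) powr (?a - 1) * \<bar>borel_rep f s\<bar>)" for s
  proof -
    consider "s \<notin> {0..1}" | "s \<in> {0..1}" "t \<le> s" | "s \<in> {0..1}" "s < t" "d < t - s"
      | "s \<in> {0..1}" "s < t" "t - s \<le> d" by fastforce
    then show ?thesis
    proof cases
      case 1
      then show ?thesis using borel_rep_outside[OF f_meas, of s] by (simp add: RL_integrand_def)
    next
      case 2
      then show ?thesis using smooth_kernel_bounds(2)[OF d a, of "t - s"]
        by (cases "s = t") (auto simp: RL_integrand_def)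
    next
      case 3
      then show ?thesis using smooth_kernel_bounds(4)[OF d a, of "t - s"] by (simp add: RL_integrand_def)
    next
      case 4
      have "?w s = ((t - s) powr (?a - 1) - smooth_kernel d (t - s) ?a) * borel_rep f s"
        using 4 by (simp add: RL_integrand_def algebra_simps)
      moreover have "\<bar>(t - s) powr (?a - 1) - smooth_kernel d (t - s) ?a\<bar> \<le> (t - s) powr (?a - 1)"
        using smooth_kernel_bounds(1,3)[OF d a, of "t - s"] 4 by auto
      ultimately show ?thesis using 4 by (simp add: abs_mult mult_right_mono)
    qed
  qed
  have bound: "\<bar>rGamma ?a * (LINT s|lborel. ?w s)\<bar> \<le> d powr ?a * m"
    by (rule RL_majorized_integral_bound(2)[OF f_meas maj a d m _ le]) measurable
  have "0 < rGamma ?a" using Gamma_real_pos[OF a] by (simp add: rGamma_inverse_Gamma)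
  then have i: "integrable lborel (\<lambda>s. smooth_kernel d (t - s) ?a * borel_rep f s)"
    using smooth_RL_bound(1)[OF d a t(2)] by (simp add: mult.assoc)
  have S: "smooth_RL d f t ?a = rGamma ?a * (LINT s|lborel. smooth_kernel d (t - s) ?a * borel_rep f s)"
    by (simp add: smooth_RL_def mult.assoc)
  have "rGamma ?a * (LINT s|lborel. ?w s) = riemann_liouville \<alpha> f t - smooth_RL d f t ?a"
    unfolding S using t i RL_majorized_riemann_liouville(1)[where \<alpha> = \<alpha>, OF f_meas maj a t m]
    by (subst Bochner_Integration.integral_diff) (auto simp: riemann_liouville_eq[OF f_meas] algebra_simps)
  with bound show ?thesis by simp
qed

end

text \<open>A finite net for the image of the unit ball.  Near 0 the operator has small norm by the hypothesis on
  \<open>t powr \<alpha> t\<close>; where \<open>\<alpha> t\<close> is large it is small because \<open>rGamma\<close> tends to 0 at infinity.  For the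
  remaining \<open>t\<close> the pair \<open>(t, \<alpha> t)\<close> stays in a compact set, on which the truncated operator has values
  that are bounded and equicontinuous in \<open>(t, a)\<close>; rounding both the pair to a grid and the values
  to multiples of \<open>e2\<close> leaves finitely many functions.\<close>

theorem riemann_liouville_compact:
  assumes p: "1 < p" and \<alpha>[measurable]: "\<alpha> \<in> borel_measurable unit_meas"
    and pos: "\<And>t. t \<in> {0<..1} \<Longrightarrow> \<alpha> t > 0"
    and low: "\<And>\<epsilon>. \<epsilon> \<in> {0<..1} \<Longrightarrow> \<exists>c>0. \<forall>t\<in>{\<epsilon>..1}. c \<le> \<alpha> t"
    and lim: "((\<lambda>t. t powr \<alpha> t) \<longlongrightarrow> 0) (at_right 0)"
  shows "compact_operator_in_Lp p (riemann_liouville \<alpha>)"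
proof -
  have bdd: "bounded_operator_in_Lp p (riemann_liouville \<alpha>)"
    by (rule riemann_liouville_bounded[OF p \<alpha> pos])
  let ?U = "{f \<in> Lp_functions p. Lp_norm p f \<le> 1}"
  obtain A where A: "0 < A" and maj: "\<And>f. f \<in> Lp_functions p \<Longrightarrow>
    \<exists>g\<in>Lp_functions p. (\<forall>t. 0 \<le> g t) \<and> Lp_norm p g \<le> A * Lp_norm p f \<and>
      (AE t in unit_meas. RL_majorized f (g t) t)"
    by (rule riemann_liouville_majorant[OF p]) blast
  obtain B :: real where B: "0 < B" "\<And>x. 0 \<le> x \<Longrightarrow> rGamma x \<le> B" by (rule rGamma_real_bounded) blast
  have "\<exists>K. finite K \<and> K \<subseteq> Lp_functions p \<and>
      (\<forall>F\<in>riemann_liouville \<alpha> ` ?U. \<exists>k\<in>K. Lp_norm p (\<lambda>t. F t - k t) \<le> e)" if e: "0 < e" for e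
  proof -
    define e1 where "e1 = e / (2 * A)"
    define e2 where "e2 = e / 4"
    have e1: "0 < e1" and e2: "0 < e2" using e A by (auto simp: e1_def e2_def)
    have "\<forall>\<^sub>F t in at_right 0. t powr \<alpha> t < e1" by (rule order_tendstoD(2)[OF lim e1])
    then obtain b where b: "0 < b" "\<And>t. 0 < t \<Longrightarrow> t < b \<Longrightarrow> t powr \<alpha> t < e1"
      unfolding eventually_at_right_field by auto
    define \<epsilon> where "\<epsilon> = min b 1"
    have \<epsilon>: "\<epsilon> \<in> {0<..1}" "\<And>t. 0 < t \<Longrightarrow> t < \<epsilon> \<Longrightarrow> t powr \<alpha> t \<le> e1"
      using b by (auto simp: \<epsilon>_def less_imp_le)
    obtain c where c: "0 < c" "\<And>t. t \<in> {\<epsilon>..1} \<Longrightarrow> c \<le> \<alpha> t" using low[OF \<epsilon>(1)] by blast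
    define d where "d = min 1 (e1 powr (1 / c))"
    have d: "0 < d" "d \<le> 1" using e1 by (auto simp: d_def)
    have dc: "d powr a \<le> e1" if "c \<le> a" for a
    proof -
      have "d powr a \<le> d powr c" using d that by (intro powr_mono') auto
      also have "\<dots> \<le> (e1 powr (1 / c)) powr c" using c d by (intro powr_mono2) (auto simp: d_def)
      also have "\<dots> = e1" using c e1 by (simp add: powr_powr)
      finally show ?thesis .
    qed
    have "\<forall>\<^sub>F a in at_top. rGamma a < d * e2 / 2"
      using d e2 by (intro order_tendstoD(2)[OF rGamma_real_tendsto_0]) auto
    then obtain N where N: "\<And>a. N \<le> a \<Longrightarrow> rGamma a < d * e2 / 2" by (auto simp: eventually_at_top_linorder)
    let ?X = "{-1..1::real} \<times> {c / 2..max N 1}"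
    let ?G = "\<lambda>x. rGamma (snd x) * smooth_kernel d (fst x) (snd x)"
    have "uniformly_continuous_on ?X ?G"
      using c by (intro compact_uniformly_continuous compact_Times continuous_on_subset[OF smooth_kernel_continuous[OF d(1)]]) auto
    then obtain \<eta> where \<eta>: "0 < \<eta>" "\<And>x y. x \<in> ?X \<Longrightarrow> y \<in> ?X \<Longrightarrow> dist y x < \<eta> \<Longrightarrow> dist (?G y) (?G x) < e2 / 2"
      unfolding uniformly_continuous_on_def using e2 by (metis half_gt_zero)
    define h where "h = min (\<eta> / 3) (c / 2)"
    have h: "0 < h" "h \<le> c / 2" "h \<le> \<eta> / 3" using \<eta> c by (auto simp: h_def)
    \<comment> \<open>The grid is so fine that the rounded order stays above \<open>c / 2\<close>, inside the compact set \<open>?X\<close>.\<close>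
    define grid where "grid x = \<lfloor>x / h\<rfloor>" for x
    have grid: "h * grid x \<le> x" "x < h * grid x + h" for x
    proof -
      have "of_int (grid x) \<le> x / h" "x / h < of_int (grid x) + 1" by (simp_all add: grid_def)
      then show "h * grid x \<le> x" "x < h * grid x + h" using h by (simp_all add: field_simps)
    qed
    have near: "\<bar>smooth_RL d f t a - smooth_RL d f (h * grid t) (h * grid a)\<bar> \<le> e2"
      if f: "f \<in> ?U" and t: "t \<in> {0..1}" and a: "c \<le> a" "a \<le> N" for f t a
    proof -
      have a': "c / 2 \<le> h * grid a" "h * grid a \<le> a" using grid[of a] a h by auto
      have t': "0 \<le> h * grid t" using h t by (simp add: grid_def)
      have "\<bar>rGamma a * smooth_kernel d (t - s) a
          - rGamma (h * grid a) * smooth_kernel d (h * grid t - s) (h * grid a)\<bar> \<le> e2 / 2" if s: "s \<in> {0..1}" for s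
      proof -
        have "dist (t - s, a) (h * grid t - s, h * grid a) \<le> \<bar>t - h * grid t\<bar> + \<bar>a - h * grid a\<bar>"
          unfolding dist_Pair_Pair by (rule order_trans[OF sqrt_sum_squares_le_sum_abs]) (simp add: dist_real_def)
        also have "\<dots> < \<eta>" using grid[of t] grid[of a] h \<eta> by (simp add: abs_real_def)
        finally have D: "dist (t - s, a) (h * grid t - s, h * grid a) < \<eta>" .
        have "(h * grid t - s, h * grid a) \<in> ?X" "(t - s, a) \<in> ?X"
          using s t t' a a' grid[of t] c by auto
        from \<eta>(2)[OF this D] show ?thesis by (simp add: dist_real_def)
      qed
      then have "\<bar>smooth_RL d f t a - smooth_RL d f (h * grid t) (h * grid a)\<bar> \<le> 2 * (e2 / 2)"
        using f t c a a' e2 grid[of t] d by (intro smooth_RL_diff[OF p]) auto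
      then show ?thesis by simp
    qed
    have quant: "e2 * of_int \<lfloor>y / e2\<rfloor> \<le> y" "y \<le> e2 * of_int \<lfloor>y / e2\<rfloor> + e2" for y
    proof -
      have "e2 * of_int \<lfloor>y / e2\<rfloor> \<le> e2 * (y / e2)" "e2 * (y / e2) \<le> e2 * (of_int \<lfloor>y / e2\<rfloor> + 1)"
        using e2 by (intro mult_left_mono; linarith)+
      then show "e2 * of_int \<lfloor>y / e2\<rfloor> \<le> y" "y \<le> e2 * of_int \<lfloor>y / e2\<rfloor> + e2"
        using e2 by (simp_all add: distrib_left)
    qed
    define I where "I = {0..\<lfloor>1 / h\<rfloor>} \<times> {1..\<lceil>max N 1 / h\<rceil>}"
    define Z where "Z = \<lceil>2 * (B / d) / e2\<rceil> + 1"
    \<comment> \<open>The net element assigned to \<open>f\<close>: the rounded values of its truncated integral at the grid points.\<close>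
    define code where "code f = restrict (\<lambda>(i, j). \<lfloor>smooth_RL d f (h * of_int i) (h * of_int j) / e2\<rfloor>) I" for f
    define k where "k q t = (if \<epsilon> \<le> t \<and> \<alpha> t \<le> N then e2 * of_int (q (grid t, grid (\<alpha> t))) else 0)"
      for q :: "int \<times> int \<Rightarrow> int" and t
    have inI: "(grid t, grid (\<alpha> t)) \<in> I" if t: "t \<in> {\<epsilon>..1}" and aN: "\<alpha> t \<le> N" for t
    proof -
      have "0 \<le> t / h" "t / h \<le> 1 / h" using t \<epsilon> h by (auto intro: divide_right_mono)
      then have "0 \<le> grid t" "grid t \<le> \<lfloor>1 / h\<rfloor>" unfolding grid_def by (auto intro: floor_mono)
      moreover have "\<alpha> t / h \<le> max N 1 / h" "1 \<le> \<alpha> t / h"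
        using aN c(2)[OF t] h by (auto intro: divide_right_mono)
      then have "1 \<le> grid (\<alpha> t)" "grid (\<alpha> t) \<le> \<lceil>max N 1 / h\<rceil>" unfolding grid_def by linarith+
      ultimately show ?thesis by (simp add: I_def)
    qed
    have code: "code f \<in> PiE I (\<lambda>_. {-Z..Z})" if f: "f \<in> ?U" for f
    proof -
      have "\<lfloor>smooth_RL d f (h * of_int i) (h * of_int j) / e2\<rfloor> \<in> {-Z..Z}" if ij: "(i, j) \<in> I" for i j
      proof -
        let ?s = "smooth_RL d f (h * of_int i) (h * of_int j)"
        have i: "of_int i \<le> 1 / h" and j: "1 \<le> j" using ij by (auto simp: I_def le_floor_iff)
        have i1: "h * of_int i \<le> 1" using i h by (simp add: field_simps)
        have j0: "0 < h * of_int j" using j h by simp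
        have "\<bar>?s\<bar> \<le> 2 * (rGamma (h * of_int j) / d)"
          using f by (intro smooth_RL_bound(2)[OF p _ _ d(1) j0 i1]) auto
        also have "\<dots> \<le> 2 * (B / d)" using B(2)[of "h * of_int j"] j0 d by (simp add: divide_right_mono)
        finally have "\<bar>?s / e2\<bar> \<le> 2 * (B / d) / e2"
          using e2 by (simp only: abs_divide abs_of_pos divide_right_mono less_imp_le)
        then show ?thesis unfolding Z_def atLeastAtMost_iff by linarith
      qed
      then show ?thesis by (auto simp: code_def)
    qed
    let ?K = "k ` PiE I (\<lambda>_. {-Z..Z})"
    have K: "k q \<in> Lp_functions p" if q: "q \<in> PiE I (\<lambda>_. {-Z..Z})" for q
    proof (rule Lp_norm_le_bound(1)[OF p])
      note [measurable] = borel_measurable_ident_unit_meas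
      have [measurable]: "grid \<in> borel \<rightarrow>\<^sub>M count_space UNIV" unfolding grid_def by measurable
      have "(\<lambda>t. (grid t, grid (\<alpha> t))) \<in> unit_meas \<rightarrow>\<^sub>M count_space UNIV \<Otimes>\<^sub>M count_space UNIV"
        by measurable
      then have "(\<lambda>t. (grid t, grid (\<alpha> t))) \<in> unit_meas \<rightarrow>\<^sub>M count_space UNIV"
        by (simp add: pair_measure_countable)
      then have [measurable]: "(\<lambda>t. real_of_int (q (grid t, grid (\<alpha> t)))) \<in> borel_measurable unit_meas"
        by (rule measurable_compose) simp
      show "k q \<in> borel_measurable unit_meas" unfolding k_def by measurable
      show "0 \<le> e2 * real_of_int \<bar>Z\<bar>" using e2 by simp
      show "AE t in unit_meas. \<bar>k q t\<bar> \<le> e2 * real_of_int \<bar>Z\<bar>"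
        using AE_unit_meas_pos
      proof eventually_elim
        case (elim t)
        show ?case
        proof (cases "\<epsilon> \<le> t \<and> \<alpha> t \<le> N")
          case True
          then have "q (grid t, grid (\<alpha> t)) \<in> {-Z..Z}" using q inI[of t] elim by (auto simp: PiE_iff)
          then have "\<bar>real_of_int (q (grid t, grid (\<alpha> t)))\<bar> \<le> real_of_int \<bar>Z\<bar>"
            unfolding atLeastAtMost_iff by linarith
          then show ?thesis using True e2 by (simp add: k_def abs_mult)
        qed (use e2 in \<open>auto simp: k_def\<close>)
      qed
    qed
    have app: "Lp_norm p (\<lambda>t. riemann_liouville \<alpha> f t - k (code f) t) \<le> e" if f: "f \<in> ?U" for f
    proof -
      have f': "f \<in> Lp_functions p" "f \<in> borel_measurable unit_meas" "Lp_norm p f \<le> 1" using f by (auto intro: Lp_measurable)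
      obtain g where g: "g \<in> Lp_functions p" "\<And>t. 0 \<le> g t" "Lp_norm p g \<le> A * Lp_norm p f"
        and AE: "AE t in unit_meas. RL_majorized f (g t) t" using maj[OF f'(1)] by blast
      have "AE t in unit_meas. \<bar>riemann_liouville \<alpha> f t - k (code f) t\<bar> \<le> \<bar>e1 * g t + 2 * e2\<bar>"
        using AE AE_unit_meas_pos
      proof eventually_elim
        case (elim t)
        have t: "0 < t" "t \<le> 1" using elim by auto
        have at: "0 < \<alpha> t" using pos t by simp
        have eg: "0 \<le> e1 * g t" using e1 g(2) by simp
        have "\<bar>riemann_liouville \<alpha> f t - k (code f) t\<bar> \<le> e1 * g t + 2 * e2"
        proof (cases "t < \<epsilon>")
          case True
          have "\<bar>riemann_liouville \<alpha> f t\<bar> \<le> t powr \<alpha> t * g t"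
            by (rule RL_majorized_riemann_liouville(2)[where \<alpha> = \<alpha>, OF f'(2) elim(1) at t g(2)])
          also have "\<dots> \<le> e1 * g t" using \<epsilon>(2)[OF t(1) True] g(2) by (intro mult_right_mono) auto
          finally show ?thesis using True e2 by (simp add: k_def)
        next
          case False
          then have tr: "t \<in> {\<epsilon>..1}" using t by simp
          have "\<bar>riemann_liouville \<alpha> f t - smooth_RL d f t (\<alpha> t)\<bar> \<le> d powr \<alpha> t * g t"
            by (rule riemann_liouville_smooth_diff[where \<alpha> = \<alpha>, OF p f'(1,3) elim(1) at d(1) t g(2)])
          also have "\<dots> \<le> e1 * g t" using dc[OF c(2)[OF tr]] g(2) by (intro mult_right_mono) auto
          finally have 1: "\<bar>riemann_liouville \<alpha> f t - smooth_RL d f t (\<alpha> t)\<bar> \<le> e1 * g t" .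
          show ?thesis
          proof (cases "\<alpha> t \<le> N")
            case True
            let ?s = "smooth_RL d f (h * grid t) (h * grid (\<alpha> t))"
            have "k (code f) t = e2 * \<lfloor>?s / e2\<rfloor>"
              using inI[OF tr True] tr True by (simp add: k_def code_def)
            moreover have "\<bar>?s - e2 * \<lfloor>?s / e2\<rfloor>\<bar> \<le> e2"
              using quant[of ?s] by linarith
            moreover have "\<bar>smooth_RL d f t (\<alpha> t) - ?s\<bar> \<le> e2" using near[OF f] t c(2)[OF tr] True by simp
            ultimately show ?thesis using 1 by linarith
          next
            case False
            have "\<bar>smooth_RL d f t (\<alpha> t)\<bar> \<le> 2 * (rGamma (\<alpha> t) / d)"
              by (rule smooth_RL_bound(2)[OF p f'(1,3) d(1) at t(2)])
            also have "\<dots> \<le> e2" using N[of "\<alpha> t"] False d by (simp add: field_simps)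
            finally show ?thesis using 1 False e2 by (simp add: k_def)
          qed
        qed
        then show ?case by linarith
      qed
      moreover have Lp: "(\<lambda>t. e1 * g t) \<in> Lp_functions p" "(\<lambda>t. 2 * e2) \<in> Lp_functions p"
        "Lp_norm p (\<lambda>t. e1 * g t) \<le> e1 * A" "Lp_norm p (\<lambda>t. 2 * e2) \<le> 2 * e2"
      proof -
        show "(\<lambda>t. e1 * g t) \<in> Lp_functions p" by (rule Lp_scale(1)[OF p g(1)])
        show "(\<lambda>t. 2 * e2) \<in> Lp_functions p" "Lp_norm p (\<lambda>t. 2 * e2) \<le> 2 * e2"
          using e2 Lp_norm_le_bound[OF p, of "\<lambda>t. 2 * e2" "2 * e2"] by auto
        have "Lp_norm p (\<lambda>t. e1 * g t) \<le> \<bar>e1\<bar> * Lp_norm p g" by (rule Lp_scale(2)[OF p g(1)])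
        also have "\<dots> \<le> e1 * (A * 1)"
          using e1 g(3) f'(3) A order_trans[OF g(3) mult_left_mono[OF f'(3), of A]]
          by (auto intro!: mult_left_mono)
        finally show "Lp_norm p (\<lambda>t. e1 * g t) \<le> e1 * A" by simp
      qed
      moreover have "(\<lambda>t. riemann_liouville \<alpha> f t - k (code f) t) \<in> borel_measurable unit_meas"
        using riemann_liouville_measurable[OF \<alpha> f'(2)] Lp_measurable[OF K[OF code[OF f]]] by measurable
      ultimately have "Lp_norm p (\<lambda>t. riemann_liouville \<alpha> f t - k (code f) t) \<le> Lp_norm p (\<lambda>t. e1 * g t + 2 * e2)"
        by (intro Lp_dominated(2)[OF p] Lp_add(1)[OF p])
      also have "\<dots> \<le> e1 * A + 2 * e2"
        using Lp_add(2)[OF p Lp(1,2)] Lp(3,4) by linarith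
      also have "\<dots> = e" using A by (simp add: e1_def e2_def)
      finally show ?thesis .
    qed
    have "finite ?K" by (intro finite_imageI finite_PiE) (auto simp: I_def)
    then show ?thesis using K app code by (intro exI[of _ ?K]) blast
  qed
  then have "compactin (Lp_topology p) (Lp_topology p closure_of (Lp_class p ` riemann_liouville \<alpha> ` ?U))"
    using bdd by (intro Lp_relatively_compactI[OF p]) (auto simp: bounded_operator_in_Lp_def)
  then show ?thesis using bdd by (simp add: compact_operator_in_Lp_def image_image)
qed

section \<open>Non-compactness\<close>

lemma Lp_indicator_interval:
  fixes a b K :: real
  assumes p: "1 < p" and ab: "0 \<le> a" "a < b" "b \<le> 1" and K: "0 \<le> K"
  shows "(\<lambda>t. K * indicator {a..b} t) \<in> Lp_functions p"
    and "Lp_norm p (\<lambda>t. K * indicator {a..b} t) = (if p = \<infinity> then K else K * (b - a) powr (1 / enn2real p))"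
proof -
  let ?f = "\<lambda>t. K * indicator {a..b} t"
  have m: "?f \<in> borel_measurable unit_meas" by (intro measurable_restrict_space1 measurable_completion) simp
  have b: "AE t in unit_meas. \<bar>?f t\<bar> \<le> K" using K by (intro AE_I2) (auto split: split_indicator)
  show Lp: "?f \<in> Lp_functions p" by (rule Lp_norm_le_bound(1)[OF p m K b])
  have em: "emeasure lborel {a..b} = ennreal (b - a)" using ab by simp
  show "Lp_norm p ?f = (if p = \<infinity> then K else K * (b - a) powr (1 / enn2real p))"
  proof (cases "p = \<infinity>")
    case True
    have "AE t in unit_meas. \<bar>?f t\<bar> \<le> Lp_norm p ?f"
      using Lp_norm_le_iff[OF p m Lp_norm_nonneg, of p ?f, THEN iffD1, OF conjI[OF Lp order_refl]] True by simp
    then have AE: "AE t in lborel. t \<in> {0..1} \<longrightarrow> \<bar>?f t\<bar> \<le> Lp_norm p ?f" by (simp only: AE_unit_meas_iff)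
    have "K \<le> Lp_norm p ?f"
    proof (rule ccontr)
      assume n: "\<not> K \<le> Lp_norm p ?f"
      have "AE t in lborel. t \<notin> {a..b}"
        using AE
      proof eventually_elim
        case (elim t)
        show ?case
        proof
          assume "t \<in> {a..b}"
          with elim ab K n show False by simp
        qed
      qed
      then have "emeasure lborel {a..b} = 0" by (subst (asm) AE_iff_measurable[of "{a..b}"]) auto
      with em ab show False by simp
    qed
    moreover have "Lp_norm p ?f \<le> K" by (rule Lp_norm_le_bound(2)[OF p m K b])
    ultimately show ?thesis using True by simp
  next
    case False
    define q where "q = enn2real p"
    have q: "1 \<le> q" using enn2real_ge_1[OF p False] by (simp add: q_def)
    have "(LINT t|unit_meas. \<bar>?f t\<bar> powr q) = (LINT t|unit_meas. K powr q * indicator {a..b} t)"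
      using K q by (intro Bochner_Integration.integral_cong) (auto split: split_indicator)
    also have "\<dots> = K powr q * measure unit_meas {a..b}"
      using ab by (simp add: space_restrict_space Int_absorb1 Int_absorb2)
    also have "measure unit_meas {a..b} = b - a"
      using ab by (simp add: measure_restrict_space)
    finally have "Lp_norm p ?f = (K powr q * (b - a)) powr (1 / q)"
      using False by (simp add: Lp_norm_def q_def)
    also have "\<dots> = K * (b - a) powr (1 / q)" using K q ab by (simp add: powr_mult powr_powr)
    finally show ?thesis using False by (simp add: q_def)
  qed
qed

lemma set_lebesgue_integral_powr_diff:
  fixes t y a :: real
  assumes "y \<le> t" "0 < a"
  shows "(LINT s:{y..t}|lebesgue. (t - s) powr (a - 1)) = (t - y) powr a / a"
proof -
  have "((\<lambda>s. (t - s) powr (a - 1)) has_integral (- ((t - t) powr a) / a - (- ((t - y) powr a) / a))) {y..t}"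
  proof (rule fundamental_theorem_of_calculus_interior[OF assms(1)])
    show "continuous_on {y..t} (\<lambda>s. - ((t - s) powr a) / a)"
      using assms by (intro continuous_intros continuous_on_powr') auto
    fix s assume s: "s \<in> {y<..<t}"
    show "((\<lambda>s. - ((t - s) powr a) / a) has_vector_derivative (t - s) powr (a - 1)) (at s)"
      unfolding has_real_derivative_iff_has_vector_derivative[symmetric] using s assms
      by (auto intro!: derivative_eq_intros simp: powr_diff)
  qed
  then have h: "((\<lambda>s. (t - s) powr (a - 1)) has_integral (t - y) powr a / a) {y..t}" using assms by simp
  then have "(\<lambda>s. (t - s) powr (a - 1)) absolutely_integrable_on {y..t}"
    by (intro nonnegative_absolutely_integrable_1) (auto simp: has_integral_integrable)
  from set_lebesgue_integral_eq_integral(2)[OF this] h show ?thesis by (simp add: integral_unique)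
qed

lemma riemann_liouville_bump:
  fixes x :: real
  assumes x: "0 < x" and a: "0 < \<alpha> t"
  shows "t \<le> x / 2 \<Longrightarrow> riemann_liouville \<alpha> (\<lambda>s. C * indicator {x/2..x} s) t = 0"
    and "x / 2 \<le> t \<Longrightarrow> t \<le> x \<Longrightarrow>
      riemann_liouville \<alpha> (\<lambda>s. C * indicator {x/2..x} s) t = C * (t - x / 2) powr \<alpha> t * rGamma (\<alpha> t + 1)"
proof -
  show "riemann_liouville \<alpha> (\<lambda>s. C * indicator {x/2..x} s) t = 0" if t: "t \<le> x / 2"
  proof -
    have zero: "indicator {0..t} s *\<^sub>R ((t - s) powr (\<alpha> t - 1) * (C * indicator {x/2..x} s)) = 0" for s
      using t by (cases "s = t") (auto split: split_indicator)
    show ?thesis unfolding riemann_liouville_def set_lebesgue_integral_def zero by simp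
  qed
  show "riemann_liouville \<alpha> (\<lambda>s. C * indicator {x/2..x} s) t = C * (t - x / 2) powr \<alpha> t * rGamma (\<alpha> t + 1)"
    if t: "x / 2 \<le> t" "t \<le> x"
  proof -
    have "(LINT s:{0..t}|lebesgue. (t - s) powr (\<alpha> t - 1) * (C * indicator {x/2..x} s))
        = (LINT s:{x/2..t}|lebesgue. C * (t - s) powr (\<alpha> t - 1))"
      unfolding set_lebesgue_integral_def using t x
      by (intro Bochner_Integration.integral_cong) (auto split: split_indicator)
    also have "\<dots> = C * ((t - x / 2) powr \<alpha> t / \<alpha> t)"
      using set_lebesgue_integral_powr_diff[OF t(1) a] by simp
    finally have I: "(LINT s:{0..t}|lebesgue. (t - s) powr (\<alpha> t - 1) * (C * indicator {x/2..x} s))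
        = C * ((t - x / 2) powr \<alpha> t / \<alpha> t)" .
    have "1 / Gamma (\<alpha> t) = \<alpha> t * rGamma (\<alpha> t + 1)"
      unfolding rGamma_plus1 by (simp add: rGamma_inverse_Gamma inverse_eq_divide)
    then show ?thesis unfolding riemann_liouville_def I using a by simp
  qed
qed

text \<open>The normalised indicators of the dyadic intervals \<open>{x n / 2..x n}\<close> lie in the unit ball.  On the upper
  half of the \<open>n\<close>-th interval the image of the \<open>n\<close>-th function is bounded below by a fixed multiple of
  the normalising constant, because \<open>t powr \<alpha> t\<close> stays away from 0, whereas the images of the functions
  with smaller index, supported further to the right, vanish there.  Hence the images are uniformly
  separated.\<close>

theorem riemann_liouville_not_compact:
  assumes p: "1 < p" and \<alpha>: "\<alpha> \<in> borel_measurable unit_meas"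
    and pos: "\<And>t. t \<in> {0<..1} \<Longrightarrow> \<alpha> t > 0"
    and c: "0 < c" and r: "0 < r" and low: "\<And>t. 0 < t \<Longrightarrow> t < r \<Longrightarrow> c \<le> t powr \<alpha> t"
  shows "\<not> compact_operator_in_Lp p (riemann_liouville \<alpha>)"
proof
  assume cpt: "compact_operator_in_Lp p (riemann_liouville \<alpha>)"
  let ?R = "riemann_liouville \<alpha>"
  let ?U = "{f \<in> Lp_functions p. Lp_norm p f \<le> 1}"
  have RU: "?R f \<in> Lp_functions p" if "f \<in> Lp_functions p" for f
    using cpt that by (simp add: compact_operator_in_Lp_def bounded_operator_in_Lp_def)
  \<comment> \<open>A bound for \<open>\<alpha>\<close> near 0: from \<open>c \<le> t powr \<alpha> t \<le> (1/2) powr \<alpha> t\<close>.\<close>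
  define K where "K = \<bar>ln c\<bar> / ln 2"
  have K: "0 \<le> K" by (simp add: K_def)
  have "\<exists>z\<in>{1..K+1}. \<forall>y\<in>{1..K+1}. rGamma z \<le> rGamma y"
    using K by (intro continuous_attains_inf continuous_on_rGamma) auto
  then obtain z where z: "z \<in> {1..K+1}" "\<And>y. y \<in> {1..K+1} \<Longrightarrow> rGamma z \<le> rGamma y" by blast
  have G: "0 < rGamma z" using Gamma_real_pos[of z] z(1) by (simp add: rGamma_inverse_Gamma)
  define \<kappa> where "\<kappa> = c ^ 3 * rGamma z"
  have \<kappa>: "0 < \<kappa>" using c G by (simp add: \<kappa>_def)
  define r' where "r' = min r (1/2)"
  have r': "0 < r'" "r' \<le> r" "r' \<le> 1/2" using r by (auto simp: r'_def)
  obtain k where k: "(1/2)^k < r'" using real_arch_pow_inv[OF r'(1), of "1/2"] by auto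
  define x where "x n = (1/2::real)^(n + k)" for n
  have x0: "0 < x n" for n by (simp add: x_def)
  have xr: "x n < r'" for n
  proof -
    have "x n \<le> (1/2)^k" unfolding x_def by (rule power_decreasing) auto
    with k show ?thesis by simp
  qed
  have x1: "x n \<le> 1" for n using xr[of n] r' by simp
  have xmn: "x n \<le> x m / 2" if "m < n" for m n
  proof -
    have "x n \<le> (1/2)^(Suc m + k)" unfolding x_def using that by (intro power_decreasing) auto
    then show ?thesis by (simp add: x_def)
  qed
  define C where "C n = (if p = \<infinity> then 1 else x n powr (- 1 / enn2real p))" for n
  have C: "0 < C n" for n using x0[of n] by (simp add: C_def)
  define f where "f n = (\<lambda>s. C n * indicator {x n / 2..x n} s)" for n
  have C_norm: "(if p = \<infinity> then M * C n else M * C n * (l * x n) powr (1 / enn2real p))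
      = (if p = \<infinity> then M else M * l powr (1 / enn2real p))" if "0 < l" for l M n
  proof (cases "p = \<infinity>")
    case False
    have "x n powr (- 1 / enn2real p) * x n powr (1 / enn2real p) = 1"
      using x0[of n] by (simp add: powr_add[symmetric])
    then show ?thesis using False that x0[of n] by (simp add: C_def powr_mult mult_ac)
  qed (simp add: C_def)
  have fU: "f n \<in> ?U" for n
  proof -
    have i: "0 \<le> x n / 2" "x n / 2 < x n" using x0[of n] by auto
    note * = Lp_indicator_interval[OF p i x1 less_imp_le[OF C[of n]]]
    have "Lp_norm p (f n) = (if p = \<infinity> then 1 else (1/2) powr (1 / enn2real p))"
      using C_norm[of "1/2" 1 n] unfolding f_def *(2) by (cases "p = \<infinity>") simp_all
    also have "\<dots> \<le> 1" by (auto intro!: powr_le1)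
    finally show ?thesis using *(1) by (simp add: f_def)
  qed
  have big: "\<kappa> * C n \<le> ?R (f n) t" if t: "t \<in> {3/4 * x n..x n}" for n t
  proof -
    have t0: "0 < t" "t < r" "t \<le> 1/2" "x n / 2 \<le> t" "t \<le> x n" using t x0[of n] xr[of n] r' by auto
    have at: "0 < \<alpha> t" using pos t0 by simp
    have ct: "c \<le> t powr \<alpha> t" using low t0 by simp
    also have th: "t powr \<alpha> t \<le> (1/2) powr \<alpha> t" using t0 at by (intro powr_mono2) auto
    finally have ch: "c \<le> (1/2) powr \<alpha> t" .
    have "ln c \<le> ln ((1/2) powr \<alpha> t)" using ch c by (intro ln_mono) auto
    then have "\<alpha> t * ln 2 \<le> \<bar>ln c\<bar>" by (simp add: ln_powr ln_div)
    then have "\<alpha> t \<le> K" by (simp add: K_def field_simps)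
    then have Gz: "rGamma z \<le> rGamma (\<alpha> t + 1)" using at by (intro z(2)) auto
    \<comment> \<open>The distance of \<open>t\<close> to the left end is at least \<open>t / 4\<close>, and \<open>(t / 4) powr \<alpha> t\<close> is a product of three factors at least \<open>c\<close>.\<close>
    have "c ^ 3 = c * (c * c)" by (simp add: power3_eq_cube)
    also have "\<dots> \<le> t powr \<alpha> t * ((1/2) powr \<alpha> t * (1/2) powr \<alpha> t)"
      using ct ch c by (intro mult_mono) auto
    also have "\<dots> = (t / 4) powr \<alpha> t"
      using t0 by (simp add: powr_mult[symmetric])
    also have "\<dots> \<le> (t - x n / 2) powr \<alpha> t"
      using t t0 at by (intro powr_mono2) auto
    finally have "c ^ 3 \<le> (t - x n / 2) powr \<alpha> t" .
    then have "\<kappa> \<le> (t - x n / 2) powr \<alpha> t * rGamma (\<alpha> t + 1)"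
      unfolding \<kappa>_def using Gz G c by (intro mult_mono) auto
    then have "C n * \<kappa> \<le> C n * ((t - x n / 2) powr \<alpha> t * rGamma (\<alpha> t + 1))"
      using C[of n] by (intro mult_left_mono) auto
    also have "\<dots> = ?R (f n) t"
      unfolding f_def using riemann_liouville_bump(2)[where \<alpha> = \<alpha>, OF x0 at t0(4,5)] by simp
    finally show ?thesis by (simp add: mult.commute)
  qed
  have sep: "\<kappa> / 4 \<le> Lp_norm p (\<lambda>t. ?R (f n) t - ?R (f m) t)" if mn: "m < n" for m n
  proof -
    let ?v = "\<lambda>t. \<kappa> * C n * indicator {3/4 * x n..x n} t"
    have i: "0 \<le> 3/4 * x n" "3/4 * x n < x n" "0 \<le> \<kappa> * C n" using x0[of n] \<kappa> C[of n] by auto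
    note v = Lp_indicator_interval[OF p i(1,2) x1 i(3)]
    have "\<kappa> / 4 \<le> (if p = \<infinity> then \<kappa> else \<kappa> * (1/4) powr (1 / enn2real p))"
    proof (cases "p = \<infinity>")
      case False
      have "(1/4::real) powr 1 \<le> (1/4) powr (1 / enn2real p)"
        using enn2real_ge_1[OF p False] by (intro powr_mono') auto
      then show ?thesis using \<kappa> False by simp
    qed (use \<kappa> in simp)
    also have "\<dots> = Lp_norm p ?v"
      using C_norm[of "1/4" \<kappa> n] unfolding v(2) by (cases "p = \<infinity>") auto
    also have "\<dots> \<le> Lp_norm p (\<lambda>t. ?R (f n) t - ?R (f m) t)"
    proof (rule Lp_dominated(2)[OF p Lp_measurable[OF v(1)]])
      show "(\<lambda>t. ?R (f n) t - ?R (f m) t) \<in> Lp_functions p" using fU by (intro Lp_diff[OF p] RU) auto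
      have "\<bar>?v t\<bar> \<le> \<bar>?R (f n) t - ?R (f m) t\<bar>" for t
      proof (cases "t \<in> {3/4 * x n..x n}")
        case True
        have "0 < \<alpha> t" using True x0[of n] x1[of n] by (intro pos) auto
        moreover have "t \<le> x m / 2" using True xmn[OF mn] by simp
        ultimately have "?R (f m) t = 0" unfolding f_def by (intro riemann_liouville_bump(1) x0)
        then show ?thesis using big[OF True] True i(3) by simp
      qed simp
      then show "AE t in unit_meas. \<bar>?v t\<bar> \<le> \<bar>?R (f n) t - ?R (f m) t\<bar>" by simp
    qed
    finally show ?thesis .
  qed
  have "compactin (Lp_topology p) (Lp_topology p closure_of (Lp_class p ` ?R ` ?U))"
    using cpt by (simp add: compact_operator_in_Lp_def image_image)
  moreover have "?R ` ?U \<subseteq> Lp_functions p" using RU by auto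
  moreover have "?R (f n) \<in> ?R ` ?U" for n by (rule imageI[OF fU])
  ultimately have "\<exists>m n. m < n \<and> Lp_norm p (\<lambda>t. ?R (f n) t - ?R (f m) t) < \<kappa> / 4"
    using \<kappa> by (intro Lp_relatively_compactD[OF p, where f = "\<lambda>n. ?R (f n)"]) auto
  then obtain m n where "m < n" "Lp_norm p (\<lambda>t. ?R (f n) t - ?R (f m) t) < \<kappa> / 4" by blast
  with sep[of m n] show False by simp
qed

section \<open>The compactness criterion\<close>

theorem theorem5p3:
  fixes \<alpha> :: "real \<Rightarrow> real" and p :: ennreal
  assumes "\<alpha> \<in> borel_measurable (lebesgue_on {0<..1})"
    and "\<And>t. t \<in> {0<..1} \<Longrightarrow> \<alpha> t > 0"
    and "\<And>\<epsilon>. \<epsilon> \<in> {0<..1} \<Longrightarrow> (INF t\<in>{\<epsilon>..1}. \<alpha> t) > 0"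
    and "1 < p"
  shows "(((\<lambda>t. t powr \<alpha> t) \<longlongrightarrow> 0) (at_right 0) \<longrightarrow>
            compact_operator_in_Lp p (riemann_liouville \<alpha>)) \<and>
         (Liminf (at_right 0) (\<lambda>t. ereal (t powr \<alpha> t)) > 0 \<longrightarrow>
            bounded_operator_in_Lp p (riemann_liouville \<alpha>) \<and>
            \<not> compact_operator_in_Lp p (riemann_liouville \<alpha>))"
proof -
  \<comment> \<open>The hypothesis says nothing about \<open>\<alpha> 0\<close>; adding the single point 0 does not affect measurability.\<close>
  have "(\<lambda>t. if t \<in> {0<..1} then \<alpha> t else 0) \<in> borel_measurable lebesgue"
    using assms(1) by (subst borel_measurable_if) auto
  then have "(\<lambda>t. (if t \<in> {0<..1} then \<alpha> t else 0) + \<alpha> 0 * indicator {0} t) \<in> borel_measurable lebesgue"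
    by (intro borel_measurable_add) (auto intro!: measurable_completion)
  then have "(\<lambda>t. (if t \<in> {0<..1} then \<alpha> t else 0) + \<alpha> 0 * indicator {0} t) \<in> borel_measurable unit_meas"
    by (rule measurable_restrict_space1)
  then have \<alpha>: "\<alpha> \<in> borel_measurable unit_meas"
    by (rule measurable_cong[THEN iffD1, rotated]) (auto split: split_indicator)
  have low: "\<exists>c>0. \<forall>t\<in>{\<epsilon>..1}. c \<le> \<alpha> t" if \<epsilon>: "\<epsilon> \<in> {0<..1}" for \<epsilon>
  proof (intro exI conjI ballI)
    show "0 < (INF t\<in>{\<epsilon>..1}. \<alpha> t)" by (rule assms(3)[OF \<epsilon>])
    fix t assume t: "t \<in> {\<epsilon>..1}"
    have "bdd_below (\<alpha> ` {\<epsilon>..1})"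
      using assms(2) \<epsilon> by (intro bdd_belowI2[of _ 0]) (auto intro: less_imp_le)
    then show "(INF t\<in>{\<epsilon>..1}. \<alpha> t) \<le> \<alpha> t" using t by (rule cINF_lower)
  qed
  have "\<not> compact_operator_in_Lp p (riemann_liouville \<alpha>)"
    if liminf: "Liminf (at_right 0) (\<lambda>t. ereal (t powr \<alpha> t)) > 0"
  proof -
    obtain c where c: "0 < ereal c" "ereal c < Liminf (at_right 0) (\<lambda>t. ereal (t powr \<alpha> t))"
      using ereal_dense2[OF liminf] by blast
    have "\<forall>\<^sub>F t in at_right 0. ereal c < ereal (t powr \<alpha> t)" by (rule less_LiminfD[OF c(2)])
    then obtain r where "0 < r" "\<And>t. 0 < t \<Longrightarrow> t < r \<Longrightarrow> c \<le> t powr \<alpha> t"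
      unfolding eventually_at_right_field by (auto simp: less_imp_le)
    with riemann_liouville_not_compact[OF assms(4) \<alpha> assms(2), of c r] c show ?thesis by simp
  qed
  then show ?thesis
    using riemann_liouville_compact[OF assms(4) \<alpha> assms(2) low] riemann_liouville_bounded[OF assms(4) \<alpha> assms(2)]
    by blast
qed

end
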